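(* Let $R>0$, $\Omega=(-R,R)$, and let $f$ be an even function on $(-R,R)$ with $\int_0^R |f(s)|(R-s)\,ds<\infty$. Suppose there is $r_0\in(0,R)$ such that $f(r)\ge 0$ for a.e. $r\in(0,r_0)$, $f^+$ is not a.e. zero on $(0,r_0)$, and $f(r)\le 0$ for a.e. $r\in(r_0,R)$. (A) Assume the balance condition $$\int_0^{r_0} f^+(s)(R-r_0)\,ds>\int_{r_0}^R f^-(s)(R-s)\,ds$$ and the decay condition $$\int_r^R\Big(\int_{r_0}^t f^-(s)\,ds\Big)dt<(R-r)\int_0^{r_0}f^+(s)\,ds\quad\text{for every } r\in(r_0,R).$$ Then every even very weak supersolution $u$ of $-u''\ge f$ in $(-R,R)$, $u(\pm R)=0$, satisfies $u>0$ in $(-R,R)$. If moreover $u\in C^1([-R,R])$, then $u'(R)\le 0$ and $u'(-R)\ge 0$. Furthermore, if the balance condition holds and $u$ is the very weak solution of $-u''=f$ in $(-R,R)$, $u(\pm R)=0$, then $u>0$ in $(-R,R)$ if and only if the decay condition holds. (B) Assume the balance and decay conditions and in addition $\int_{r_0}^R f^-(s)\,ds<\infty$. Let $u$ be the unique very weak solution of $-u''=f$ in $(-R,R)$, $u(\pm R)=0$. Then $u\in C^1([-R,R])$, and $u'(\pm R)=0$ (i.e. $u$ is flat) if and only if $\int_0^{r_0}f^+(s)\,ds=\int_{r_0}^R f^-(s)\,ds$, i.e. $\int_0^R f(s)\,ds=0$.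
   Context: $f^+=\max(f,0)$, $f^-=-\min(f,0)$, so $f=f^+-f^-$. $\delta(x)=\operatorname{dist}(x,\partial\Omega)$ and $L^1(\Omega:\delta)=\{g\in L^1_{loc}(\Omega):\int_\Omega|g|\delta<\infty\}$. A very weak supersolution of $-u''\ge f$ in $\Omega$, $u=0$ on $\partial\Omega$ (with $f\in L^1(\Omega:\delta)$) is a function $u\in L^1(\Omega)$ such that $-\int_\Omega u\psi''\ge\int_\Omega f\psi$ for every $\psi\in W^{2,\infty}(\Omega)\cap W^{1,\infty}_0(\Omega)$ with $\psi\ge0$; a very weak solution is defined in the same way with equality for all $\psi\in W^{2,\infty}(\Omega)\cap W^{1,\infty}_0(\Omega)$. Such a solution exists and is unique, and for even data it is even. *)

theory Defs
  imports "HOL-Analysis.Analysis"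
begin

definition fplus :: "(real \<Rightarrow> real) \<Rightarrow> real \<Rightarrow> real" where
  "fplus f x = max (f x) 0"

definition fminus :: "(real \<Rightarrow> real) \<Rightarrow> real \<Rightarrow> real" where
  "fminus f x = - min (f x) 0"

text \<open>Test functions psi in W^{2,infty}(-R,R) \<inter> W^{1,infty}_0(-R,R):
  psi is differentiable on [-R,R] with derivative psi1, psi1 is absolutely continuous
  with bounded measurable derivative psi2 (so psi1 is Lipschitz), and psi(\<plusminus>R) = 0.
  psi2 plays the role of psi''.\<close>
definition test_fun :: "real \<Rightarrow> (real \<Rightarrow> real) \<Rightarrow> (real \<Rightarrow> real) \<Rightarrow> bool" where
  "test_fun R \<psi> \<psi>2 \<longleftrightarrow>
     \<psi>2 measurable_on {-R..R} \<and> bounded (\<psi>2 ` {-R..R}) \<and>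
     (\<exists>\<psi>1. (\<forall>x\<in>{-R..R}. (\<psi> has_real_derivative \<psi>1 x) (at x within {-R..R})) \<and>
           (\<forall>x\<in>{-R..R}. \<psi>1 x = \<psi>1 (-R) + integral {-R..x} \<psi>2)) \<and>
     \<psi> (-R) = 0 \<and> \<psi> R = 0"

definition very_weak_supersol :: "real \<Rightarrow> (real \<Rightarrow> real) \<Rightarrow> (real \<Rightarrow> real) \<Rightarrow> bool" where
  "very_weak_supersol R f u \<longleftrightarrow>
     u absolutely_integrable_on {-R<..<R} \<and>
     (\<forall>\<psi> \<psi>2. test_fun R \<psi> \<psi>2 \<and> (\<forall>x\<in>{-R<..<R}. \<psi> x \<ge> 0) \<longrightarrow>
        - integral {-R<..<R} (\<lambda>x. u x * \<psi>2 x) \<ge> integral {-R<..<R} (\<lambda>x. f x * \<psi> x))"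

definition very_weak_sol :: "real \<Rightarrow> (real \<Rightarrow> real) \<Rightarrow> (real \<Rightarrow> real) \<Rightarrow> bool" where
  "very_weak_sol R f u \<longleftrightarrow>
     u absolutely_integrable_on {-R<..<R} \<and>
     (\<forall>\<psi> \<psi>2. test_fun R \<psi> \<psi>2 \<longrightarrow>
        - integral {-R<..<R} (\<lambda>x. u x * \<psi>2 x) = integral {-R<..<R} (\<lambda>x. f x * \<psi> x))"

definition C1_on :: "real \<Rightarrow> (real \<Rightarrow> real) \<Rightarrow> (real \<Rightarrow> real) \<Rightarrow> bool" where
  "C1_on R v v' \<longleftrightarrow> continuous_on {-R..R} v' \<and>
     (\<forall>x\<in>{-R..R}. (v has_real_derivative v' x) (at x within {-R..R}))"

end

theory Submission
  imports Defs
begin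

text \<open>
  For even data the solution is the potential
  \<open>green R f x = \<integral>\<^sub>0\<^sup>R f s (R - max s \<bar>x\<bar>) ds\<close>. Fubini and the symmetry of this kernel show
  that it is a very weak solution. Testing with the potential of \<open>sgn (u - green R f)\<close> gives uniqueness,
  and testing with the potential of the indicator of \<open>{u < green R f}\<close> gives
  \<open>u \<ge> green R f\<close> for even supersolutions.

  The potential is nonincreasing on \<open>[0, r0]\<close> and convex on \<open>[r0, R]\<close> with value \<open>0\<close> at \<open>R\<close>;
  the balance condition says that it is positive at \<open>r0\<close>, the decay condition that it is positive on
  \<open>(r0, R)\<close>. If \<open>f\<close> is integrable up to \<open>R\<close>, its derivative at \<open>x \<ge> 0\<close> is
  \<open>- \<integral>\<^sub>0\<^sup>x f\<close>, which yields the flatness criterion.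
\<close>

text \<open>The kernel is a folded Green function. On the whole interval the Dirichlet problem has
  \<open>G(x,s) = (R - max x s) * (R + min x s) / (2 * R)\<close>. Even data only see
  \<open>G(x,s) + G(x,-s)\<close>, which for x, s \<ge> 0 collapses to \<open>R - max s x\<close>.
  As this is at most \<open>R - s\<close>, weighted integrability of f keeps the potential bounded
  up to the ends.

  Two obstacles shape the argument. First, f need not be integrable near R, so the potential may
  have no derivative there; its convexity is therefore used as a comparison of values with the
  linear function \<open>R - x\<close>. Second, a very weak supersolution carries no boundary value:
  for f = 0 every positive constant is one. Hence \<open>u'(R) \<le> 0\<close> cannot be read off
  from \<open>u > 0\<close> inside and \<open>u = 0\<close> at the ends. It rests instead on
  \<open>u - green R f\<close> being even and weakly concave, so nonincreasing on
  \<open>[0, R]\<close>, while under the decay condition the potential itself is nonincreasing on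
  \<open>(r0, R)\<close>.\<close>

definition green :: "real \<Rightarrow> (real \<Rightarrow> real) \<Rightarrow> real \<Rightarrow> real" where
  "green R k x = (\<integral>s. k s * (R - max s \<bar>x\<bar>) \<partial>lebesgue_on {0<..<R})"

abbreviation weighted_integrable :: "real \<Rightarrow> (real \<Rightarrow> real) \<Rightarrow> bool" where
  "weighted_integrable R k \<equiv> integrable (lebesgue_on {0<..<R}) (\<lambda>s. k s * (R - s))"

section \<open>Integrability and measurability on intervals\<close>

lemma absolutely_integrable_on_iff_integrable:
  fixes f :: "'a::euclidean_space \<Rightarrow> 'b::euclidean_space"
  assumes "S \<in> sets lebesgue"
  shows "f absolutely_integrable_on S \<longleftrightarrow> integrable (lebesgue_on S) f"
  using assms by (simp add: set_integrable_def integrable_restrict_space)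

lemma absolutely_integrable_bounded_on_interval:
  fixes g :: "real \<Rightarrow> real"
  assumes "g \<in> borel_measurable (lebesgue_on {a..b})" "bounded (g ` {a..b})"
  shows "g absolutely_integrable_on {a..b}"
  using absolutely_integrable_bounded_measurable_product_real[OF assms(1) _ assms(2), of "\<lambda>x. 1"]
  by (simp add: absolutely_integrable_continuous_real)

text \<open>Completing a measure does not change its almost-everywhere statements. This links the
  \<open>lborel\<close> form used in the theorem with the spaces \<open>lebesgue_on S\<close> on
  which the Bochner integrals live.\<close>

lemma AE_lborel_on_iff:
  "(AE x in lborel. x \<in> S \<longrightarrow> P x) \<longleftrightarrow> (AE x in lebesgue_on S. P x)" if "S \<in> sets borel"
  using that by (subst AE_restrict_space_iff) (auto simp: AE_completion_iff)

lemma borel_imp_lebesgue_on_measurable: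
  "g \<in> borel_measurable borel \<Longrightarrow> g \<in> borel_measurable (lebesgue_on S)"
  for g :: "'a::euclidean_space \<Rightarrow> 'b::topological_space"
  by (intro measurable_restrict_space1 measurable_completion) simp

lemma weighted_integrable_measurable:
  assumes "weighted_integrable R k"
  shows "k \<in> borel_measurable (lebesgue_on {0<..<R})"
proof -
  have "(\<lambda>s. k s * (R - s) / (R - s)) \<in> borel_measurable (lebesgue_on {0<..<R})"
    by (intro borel_measurable_divide borel_measurable_integrable[OF assms]
        borel_imp_lebesgue_on_measurable[of "\<lambda>s. R - s"]) simp
  then show ?thesis
    by (rule measurable_cong[THEN iffD1, rotated]) auto
qed

lemma bounded_weighted_integrable:
  assumes "k \<in> borel_measurable (lebesgue_on {0<..<R})"
    and "\<And>s. s \<in> {0<..<R} \<Longrightarrow> \<bar>k s\<bar> \<le> C"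
  shows "weighted_integrable R k"
proof (rule Bochner_Integration.integrable_bound)
  interpret finite_measure "lebesgue_on {0<..<R}"
    by (rule finite_measure_lebesgue_on) auto
  show "integrable (lebesgue_on {0<..<R}) (\<lambda>s. C * R)" by simp
  show "(\<lambda>s. k s * (R - s)) \<in> borel_measurable (lebesgue_on {0<..<R})"
    by (intro borel_measurable_times assms(1) borel_imp_lebesgue_on_measurable[of "\<lambda>s. R - s"]) auto
  show "AE s in lebesgue_on {0<..<R}. norm (k s * (R - s)) \<le> norm (C * R)"
  proof (rule AE_I2)
    fix s assume "s \<in> space (lebesgue_on {0<..<R})"
    then have s: "s \<in> {0<..<R}" by simp
    have "\<bar>k s\<bar> * \<bar>R - s\<bar> \<le> C * R"
      using assms(2)[OF s] s by (intro mult_mono) auto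
    also have "\<dots> \<le> \<bar>C * R\<bar>" by simp
    finally show "norm (k s * (R - s)) \<le> norm (C * R)"
      by (simp add: abs_mult)
  qed
qed

section \<open>The potential: bounds, symmetry, integral representation\<close>

text \<open>The kernel \<open>R - max s \<bar>x\<bar>\<close> lies between 0 and the weight
  \<open>R - s\<close>, so the weighted integral dominates.\<close>

lemma green_integrable:
  assumes k: "weighted_integrable R k" and x: "\<bar>x\<bar> \<le> R"
  shows "integrable (lebesgue_on {0<..<R}) (\<lambda>s. k s * (R - max s \<bar>x\<bar>))"
proof (rule Bochner_Integration.integrable_bound[OF k])
  show "(\<lambda>s. k s * (R - max s \<bar>x\<bar>)) \<in> borel_measurable (lebesgue_on {0<..<R})"
    by (intro borel_measurable_times weighted_integrable_measurable[OF k]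
        borel_imp_lebesgue_on_measurable[of "\<lambda>s. R - max s \<bar>x\<bar>"]) auto
  show "AE s in lebesgue_on {0<..<R}. norm (k s * (R - max s \<bar>x\<bar>)) \<le> norm (k s * (R - s))"
    using x by (auto intro!: mult_left_mono simp: abs_mult)
qed

lemma green_bound:
  assumes k: "weighted_integrable R k" and x: "\<bar>x\<bar> \<le> R"
  shows "\<bar>green R k x\<bar> \<le> (\<integral>s. \<bar>k s * (R - s)\<bar> \<partial>lebesgue_on {0<..<R})"
proof -
  have "\<bar>green R k x\<bar> \<le> (\<integral>s. \<bar>k s * (R - max s \<bar>x\<bar>)\<bar> \<partial>lebesgue_on {0<..<R})"
    unfolding green_def by (rule integral_abs_bound)
  also have "\<dots> \<le> (\<integral>s. \<bar>k s * (R - s)\<bar> \<partial>lebesgue_on {0<..<R})"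
    using x k by (intro integral_mono_AE integrable_abs green_integrable)
      (auto intro!: mult_left_mono simp: abs_mult)
  finally show ?thesis .
qed

lemma green_measurable:
  assumes k: "weighted_integrable R k"
  shows "green R k \<in> borel_measurable borel"
proof -
  interpret finite_measure "lebesgue_on {0<..<R}"
    by (rule finite_measure_lebesgue_on) auto
  note [measurable] = weighted_integrable_measurable[OF k]
  have [measurable]: "(\<lambda>x. x) \<in> borel_measurable (lebesgue_on {0<..<R})"
    by (intro borel_imp_lebesgue_on_measurable) auto
  have "(\<lambda>x. \<integral>s. k s * (R - max s \<bar>x\<bar>) \<partial>lebesgue_on {0<..<R}) \<in> borel_measurable borel"
    by (intro borel_measurable_lebesgue_integral) measurable
  then show ?thesis by (simp add: green_def[abs_def])
qed

lemma green_even [simp]: "green R k (- x) = green R k x"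
  by (simp add: green_def)

text \<open>Fubini for a symmetric kernel. The two densities play different roles: k is only
  integrable against the weight, and boundedness of h pays for this, since
  \<open>\<bar>h y\<bar> * (R - max s y) \<le> C * (R - s)\<close> supplies the missing
  factor.\<close>

lemma integral_green_swap:
  assumes k: "weighted_integrable R k"
    and h: "h \<in> borel_measurable (lebesgue_on {0<..<R})"
    and C: "\<And>s. s \<in> {0<..<R} \<Longrightarrow> \<bar>h s\<bar> \<le> C"
  shows "(\<integral>s. k s * green R h s \<partial>lebesgue_on {0<..<R})
       = (\<integral>s. h s * green R k s \<partial>lebesgue_on {0<..<R})"
proof -
  let ?M = "lebesgue_on {0<..<R}"
  interpret M: finite_measure ?M
    by (rule finite_measure_lebesgue_on) auto
  interpret pair_sigma_finite ?M ?M ..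
  note [measurable] = weighted_integrable_measurable[OF k] h
  have [measurable]: "(\<lambda>x. x) \<in> borel_measurable ?M"
    by (intro borel_imp_lebesgue_on_measurable) auto
  define p where "p = (\<lambda>(s, y). k s * (h y * (R - max s y)))"
  have pm[measurable]: "p \<in> borel_measurable (?M \<Otimes>\<^sub>M ?M)"
    unfolding p_def by measurable
  have bd: "\<bar>p (s, y)\<bar> \<le> C * \<bar>k s * (R - s)\<bar>" if "s \<in> {0<..<R}" "y \<in> {0<..<R}" for s y
  proof -
    have "\<bar>h y\<bar> * (R - max s y) \<le> C * (R - s)"
      using C[OF that(2)] that by (intro mult_mono) auto
    then have "\<bar>k s\<bar> * (\<bar>h y\<bar> * (R - max s y)) \<le> \<bar>k s\<bar> * (C * (R - s))"
      by (rule mult_left_mono) auto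
    moreover have "\<bar>R - max s y\<bar> = R - max s y" "\<bar>R - s\<bar> = R - s" using that by auto
    ultimately show ?thesis by (simp add: p_def abs_mult mult_ac)
  qed
  have "integrable (?M \<Otimes>\<^sub>M ?M) p"
  proof (rule Fubini_integrable)
    have i: "integrable ?M (\<lambda>y. p (s, y))" if "s \<in> {0<..<R}" for s
      by (rule M.integrable_const_bound[where B="C * \<bar>k s * (R - s)\<bar>"])
        (use bd that in \<open>auto intro!: AE_I2 simp: p_def\<close>)
    then show "AE s in ?M. integrable ?M (\<lambda>y. p (s, y))" by (intro AE_I2) auto
    show "integrable ?M (\<lambda>s. \<integral>y. norm (p (s, y)) \<partial>?M)"
    proof (rule Bochner_Integration.integrable_bound)
      show "integrable ?M (\<lambda>s. (C * measure ?M (space ?M)) * \<bar>k s * (R - s)\<bar>)"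
        using k by (intro integrable_mult_right integrable_abs)
      show "(\<lambda>s. \<integral>y. norm (p (s, y)) \<partial>?M) \<in> borel_measurable ?M" by measurable
      show "AE s in ?M. norm (\<integral>y. norm (p (s, y)) \<partial>?M)
          \<le> norm (C * measure ?M (space ?M) * \<bar>k s * (R - s)\<bar>)"
      proof (rule AE_I2)
        fix s assume "s \<in> space ?M"
        then have s: "s \<in> {0<..<R}" by simp
        have "(\<integral>y. norm (p (s, y)) \<partial>?M) \<le> (\<integral>y. C * \<bar>k s * (R - s)\<bar> \<partial>?M)"
          using bd[OF s] i[OF s] by (intro integral_mono_AE integrable_norm) (auto intro!: AE_I2)
        also have "\<dots> = C * measure ?M (space ?M) * \<bar>k s * (R - s)\<bar>" by simp
        finally show "norm (\<integral>y. norm (p (s, y)) \<partial>?M)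
          \<le> norm (C * measure ?M (space ?M) * \<bar>k s * (R - s)\<bar>)" by simp
      qed
    qed
  qed fact
  then have "(\<integral>y. (\<integral>s. k s * (h y * (R - max s y)) \<partial>?M) \<partial>?M)
      = (\<integral>s. (\<integral>y. k s * (h y * (R - max s y)) \<partial>?M) \<partial>?M)"
    unfolding p_def by (rule Fubini_integral)
  moreover have "(\<integral>y. (\<integral>s. k s * (h y * (R - max s y)) \<partial>?M) \<partial>?M)
      = (\<integral>y. h y * green R k y \<partial>?M)"
    by (intro Bochner_Integration.integral_cong)
      (simp_all add: green_def mult.left_commute[of _ "h _"])
  moreover have "(\<integral>s. (\<integral>y. k s * (h y * (R - max s y)) \<partial>?M) \<partial>?M)
      = (\<integral>s. k s * green R h s \<partial>?M)"
    by (intro Bochner_Integration.integral_cong) (simp_all add: green_def max.commute)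
  ultimately show ?thesis by simp
qed

text \<open>Away from R the weight stays above \<open>R - t > 0\<close> and can be divided
  out.\<close>

lemma weighted_integrable_on_subinterval:
  assumes k: "weighted_integrable R k" and "t < R"
  shows "k absolutely_integrable_on {0..t}"
proof -
  have k': "(\<lambda>s. k s * (R - s)) absolutely_integrable_on {0<..<R}"
    using k by (simp add: absolutely_integrable_on_iff_integrable)
  have a: "(\<lambda>s. k s * (R - s)) absolutely_integrable_on {0<..<t}"
    by (rule set_integrable_subset[OF k']) (use assms in auto)
  have "(\<lambda>s. inverse (R - s) * (k s * (R - s))) absolutely_integrable_on {0<..<t}"
  proof (rule absolutely_integrable_bounded_measurable_product_real[OF _ _ _ a])
    show "(\<lambda>s. inverse (R - s)) \<in> borel_measurable (lebesgue_on {0<..<t})"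
      by (rule borel_imp_lebesgue_on_measurable) auto
    show "bounded ((\<lambda>s. inverse (R - s)) ` {0<..<t})"
      unfolding bounded_iff using assms
      by (intro exI[of _ "inverse (R - t)"]) (auto intro!: le_imp_inverse_le)
  qed auto
  then have "k absolutely_integrable_on {0<..<t}"
    by (rule set_integrable_cong[THEN iffD1, rotated -1]) (use assms in auto)
  then show ?thesis by (simp add: absolutely_integrable_on_Icc_iff_Ioo)
qed

text \<open>Layer-cake argument: \<open>R - max y x\<close> is the length of the interval from
  \<open>max y x\<close> to R, so the potential is a double integral over pairs with
  \<open>max y x < t\<close>, and exchanging the order leaves the mass of k below t. This is the
  integrated form of \<open>- U' t = integral {0..t} k\<close> with \<open>U R = 0\<close>.\<close>

lemma green_has_integral:
  assumes k: "weighted_integrable R k" and x: "0 \<le> x" "x \<le> R"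
  shows "((\<lambda>t. integral {0..t} k) has_integral green R k x) {x..R}"
proof -
  let ?M = "lebesgue_on {0<..<R}"
  interpret M: finite_measure ?M
    by (rule finite_measure_lebesgue_on) auto
  interpret pair_sigma_finite ?M ?M ..
  note [measurable] = weighted_integrable_measurable[OF k]
  have [measurable]: "(\<lambda>x. x) \<in> borel_measurable ?M"
    by (intro borel_imp_lebesgue_on_measurable) auto
  define w where "w = (\<lambda>y t. if max y x < t then 1 else 0 :: real)"
  define p where "p = (\<lambda>(y, t). k y * w y t)"
  have w_int: "(\<integral>t. w y t \<partial>?M) = R - max y x" if "y \<in> {0<..<R}" for y
  proof -
    have "(\<integral>t. w y t \<partial>?M) = (\<integral>t. indicator {max y x<..<R} t \<partial>?M)"
      by (intro Bochner_Integration.integral_cong) (auto simp: w_def)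
    also have "\<dots> = measure ?M {max y x<..<R}"
      using that x by (simp add: Int_absorb2 subset_eq)
    also have "\<dots> = R - max y x"
      using that x by (subst measure_restrict_space) (auto simp: subset_eq)
    finally show ?thesis .
  qed
  have [measurable]: "p \<in> borel_measurable (?M \<Otimes>\<^sub>M ?M)"
    unfolding p_def w_def by measurable
  have "integrable (?M \<Otimes>\<^sub>M ?M) p"
  proof (rule Fubini_integrable)
    show "AE y in ?M. integrable ?M (\<lambda>t. p (y, t))"
    proof (rule AE_I2)
      fix y
      show "integrable ?M (\<lambda>t. p (y, t))"
        by (rule M.integrable_const_bound[where B="\<bar>k y\<bar>"]) (auto simp: p_def w_def)
    qed
    have "integrable ?M (\<lambda>y. \<bar>k y * (R - max y \<bar>x\<bar>)\<bar>)"
      using x by (intro integrable_abs green_integrable[OF k]) auto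
    then show "integrable ?M (\<lambda>y. \<integral>t. norm (p (y, t)) \<partial>?M)"
    proof (rule Bochner_Integration.integrable_cong[THEN iffD1, rotated -1])
      fix y assume "y \<in> space ?M"
      then have y: "y \<in> {0<..<R}" by simp
      have "(\<integral>t. norm (p (y, t)) \<partial>?M) = (\<integral>t. \<bar>k y\<bar> * w y t \<partial>?M)"
        by (intro Bochner_Integration.integral_cong) (auto simp: p_def w_def)
      also have "\<dots> = \<bar>k y\<bar> * (R - max y x)" using w_int[OF y] by simp
      also have "\<dots> = \<bar>k y * (R - max y \<bar>x\<bar>)\<bar>" using y x by (simp add: abs_mult)
      finally show "\<bar>k y * (R - max y \<bar>x\<bar>)\<bar> = (\<integral>t. norm (p (y, t)) \<partial>?M)" by simp
    qed simp
  qed fact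
  then have p: "integrable (?M \<Otimes>\<^sub>M ?M) (case_prod (\<lambda>y t. k y * w y t))"
    by (simp add: p_def)
  \<comment> \<open>The inner integral vanishes for \<open>t \<le> x\<close>. Writing the cutoff as
    membership in \<open>{x<..}\<close> lets \<open>has_integral_restrict_Int\<close> turn it into a
    change of domain at the end.\<close>
  define I where "I = (\<lambda>t. if t \<in> {x<..} then integral {0..t} k else 0)"
  have inner: "(\<integral>y. k y * w y t \<partial>?M) = I t" if t: "t \<in> {0<..<R}" for t
  proof (cases "x < t")
    case True
    have kt: "k absolutely_integrable_on {0<..<t}"
      using weighted_integrable_on_subinterval[OF k, of t] t
      by (simp add: absolutely_integrable_on_Icc_iff_Ioo)
    have "(\<integral>y. k y * w y t \<partial>?M) = (\<integral>y. indicator {0<..<t} y *\<^sub>R k y \<partial>?M)"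
      using True by (intro Bochner_Integration.integral_cong) (auto simp: w_def indicator_def)
    also have "\<dots> = (\<integral>y. indicator {0<..<R} y *\<^sub>R (indicator {0<..<t} y *\<^sub>R k y) \<partial>lebesgue)"
      by (rule integral_restrict_space) auto
    also have "\<dots> = (\<integral>y. indicator {0<..<t} y *\<^sub>R k y \<partial>lebesgue)"
      using t by (intro Bochner_Integration.integral_cong) (auto simp: indicator_def)
    also have "\<dots> = integral {0<..<t} k"
      using set_lebesgue_integral_eq_integral(2)[OF kt] by (simp add: set_lebesgue_integral_def)
    finally show ?thesis using True by (simp add: I_def integral_open_interval_real)
  next
    case False
    then have "(\<integral>y. k y * w y t \<partial>?M) = (\<integral>y. 0 \<partial>?M)"
      by (intro Bochner_Integration.integral_cong) (auto simp: w_def)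
    then show ?thesis using False by (simp add: I_def)
  qed
  have "integrable ?M (\<lambda>t. \<integral>y. k y * w y t \<partial>?M)"
    using integrable_snd[OF p] .
  then have I: "integrable ?M I"
    by (rule Bochner_Integration.integrable_cong[THEN iffD1, rotated -1]) (auto simp: inner)
  have "integral\<^sup>L ?M I = (\<integral>t. \<integral>y. k y * w y t \<partial>?M \<partial>?M)"
    by (intro Bochner_Integration.integral_cong) (auto simp: inner)
  also have "\<dots> = (\<integral>y. \<integral>t. k y * w y t \<partial>?M \<partial>?M)"
    by (rule Fubini_integral[OF p])
  also have "\<dots> = green R k x"
    unfolding green_def using x by (intro Bochner_Integration.integral_cong) (auto simp: w_int)
  finally have "(I has_integral green R k x) {0<..<R}"
    using has_integral_integral_lebesgue_on[OF I] by simp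
  then have "((\<lambda>t. integral {0..t} k) has_integral green R k x) ({x<..} \<inter> {0<..<R})"
    unfolding I_def by (subst (asm) has_integral_restrict_Int)
  moreover have "{x<..} \<inter> {0<..<R} = {x<..<R}" using x by auto
  ultimately show ?thesis by (simp add: has_integral_Icc_iff_Ioo)
qed

section \<open>Test functions: construction, folding, boundary decay\<close>

lemma test_fun_derivative:
  assumes "test_fun R \<psi> \<psi>2"
  obtains \<psi>1 where "\<And>x. x \<in> {-R..R} \<Longrightarrow> (\<psi> has_real_derivative \<psi>1 x) (at x within {-R..R})"
    "\<And>x. x \<in> {-R..R} \<Longrightarrow> \<psi>1 x = \<psi>1 (-R) + integral {-R..x} \<psi>2"
  using assms unfolding test_fun_def by blast

lemma test_fun_boundary:
  assumes "test_fun R \<psi> \<psi>2"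
  shows "\<psi> (-R) = 0" "\<psi> R = 0"
  using assms unfolding test_fun_def by blast+

lemma test_fun_second_derivative:
  assumes "test_fun R \<psi> \<psi>2"
  shows "\<psi>2 \<in> borel_measurable (lebesgue_on {-R..R})" "bounded (\<psi>2 ` {-R..R})"
proof -
  have "\<psi>2 measurable_on {-R..R}" "bounded (\<psi>2 ` {-R..R})"
    using assms unfolding test_fun_def by blast+
  then show "\<psi>2 \<in> borel_measurable (lebesgue_on {-R..R})" "bounded (\<psi>2 ` {-R..R})"
    by (simp_all add: measurable_on_iff_borel_measurable)
qed

lemma test_funI:
  assumes "\<psi>2 \<in> borel_measurable (lebesgue_on {-R..R})" "bounded (\<psi>2 ` {-R..R})"
    and "\<And>x. x \<in> {-R..R} \<Longrightarrow> (\<psi> has_real_derivative \<psi>' x) (at x within {-R..R})"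
    and "\<And>x. x \<in> {-R..R} \<Longrightarrow> \<psi>' x = \<psi>' (-R) + integral {-R..x} \<psi>2"
    and "\<psi> (-R) = 0" "\<psi> R = 0"
  shows "test_fun R \<psi> \<psi>2"
  unfolding test_fun_def
proof (intro conjI exI[of _ \<psi>'] ballI)
  show "\<psi>2 measurable_on {-R..R}"
    using assms(1) by (simp add: measurable_on_iff_borel_measurable)
qed (fact assms | rule assms, assumption)+

lemma test_fun_absolutely_integrable:
  assumes "test_fun R \<psi> \<psi>2"
  shows "\<psi>2 absolutely_integrable_on {-R..R}"
  by (rule absolutely_integrable_bounded_on_interval[OF test_fun_second_derivative[OF assms]])

text \<open>Integrating twice from \<open>-R\<close> leaves the initial slope free, and the slope c
  is spent on the second boundary condition: \<open>\<psi> R\<close> is \<open>2 * R * c\<close>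
  plus the double integral of \<phi>. Discontinuous second derivatives such as a sign or an
  indicator are thus available for duality arguments.\<close>

lemma test_fun_exists:
  assumes R: "R > 0" and m: "\<phi> \<in> borel_measurable (lebesgue_on {-R..R})"
    and b: "bounded (\<phi> ` {-R..R})"
  obtains \<psi> where "test_fun R \<psi> \<phi>"
proof -
  have "\<phi> integrable_on {-R..R}"
    using absolutely_integrable_bounded_on_interval[OF m b]
    by (rule set_lebesgue_integral_eq_integral(1))
  then have cont: "continuous_on {-R..R} (\<lambda>x. integral {-R..x} \<phi>)"
    by (rule indefinite_integral_continuous_1)
  define c where "c = - integral {-R..R} (\<lambda>x. integral {-R..x} \<phi>) / (2 * R)"
  define \<psi>1 where "\<psi>1 = (\<lambda>x. c + integral {-R..x} \<phi>)"
  define \<psi> where "\<psi> = (\<lambda>x. integral {-R..x} \<psi>1)"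
  have cont1: "continuous_on {-R..R} \<psi>1"
    unfolding \<psi>1_def by (intro continuous_intros cont)
  have "\<psi> R = integral {-R..R} (\<lambda>x. c) + integral {-R..R} (\<lambda>x. integral {-R..x} \<phi>)"
    unfolding \<psi>_def \<psi>1_def
    by (intro Henstock_Kurzweil_Integration.integral_add integrable_continuous_real cont) auto
  also have "\<dots> = 0" using R by (simp add: c_def)
  finally have "\<psi> R = 0" .
  then have "test_fun R \<psi> \<phi>"
  proof (intro test_funI[where \<psi>'=\<psi>1] m b)
    show "(\<psi> has_real_derivative \<psi>1 x) (at x within {-R..R})" if "x \<in> {-R..R}" for x
      unfolding \<psi>_def by (rule integral_has_real_derivative[OF cont1 that])
  qed (simp_all add: \<psi>_def \<psi>1_def)
  then show thesis by (rule that)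
qed

lemma has_derivative_reflect_interval:
  assumes "\<And>x. x \<in> {-R..R} \<Longrightarrow> (g has_real_derivative g' x) (at x within {-R..R})"
    and "x \<in> {-R..R}"
  shows "((\<lambda>x. g (- x)) has_real_derivative - g' (- x)) (at x within {-R..R})"
proof -
  have "((g \<circ> uminus) has_real_derivative g' (- x) * (-1)) (at x within {-R..R})"
  proof (rule DERIV_image_chain)
    have "uminus ` {-R..R} = {-R..R}" by simp
    then show "(g has_real_derivative g' (- x)) (at (- x) within uminus ` {-R..R})"
      using assms(1)[of "- x"] assms(2) by auto
  qed (auto intro!: derivative_eq_intros)
  then show ?thesis by (simp add: o_def)
qed

text \<open>Lebesgue measurability survives composition only with maps that respect null sets; for
  negation this is scaling by -1. Extending h by 0 moves the question to the whole line.\<close>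

lemma measurable_reflect_interval:
  fixes h :: "real \<Rightarrow> real"
  assumes "h \<in> borel_measurable (lebesgue_on {-R..R})"
  shows "(\<lambda>x. h (- x)) \<in> borel_measurable (lebesgue_on {-R..R})"
proof -
  have "(*\<^sub>R) (-1) = (uminus :: real \<Rightarrow> real)" by (simp add: fun_eq_iff)
  then have uminus: "(uminus :: real \<Rightarrow> real) \<in> lebesgue \<rightarrow>\<^sub>M lebesgue"
    using lebesgue_measurable_scaling[of "-1", where 'a=real] by simp
  have "(\<lambda>x. if x \<in> {-R..R} then h x else 0) \<in> borel_measurable lebesgue"
    using assms by (subst borel_measurable_if) auto
  then have "(\<lambda>x. if - x \<in> {-R..R} then h (- x) else 0) \<in> borel_measurable lebesgue"
    by (rule measurable_compose[rotated]) (rule uminus)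
  moreover have "(\<lambda>x. if - x \<in> {-R..R} then h (- x) else 0)
      = (\<lambda>x. if x \<in> {-R..R} then h (- x) else 0)" by auto
  ultimately show ?thesis using borel_measurable_if[of "{-R..R}" "\<lambda>x. h (-x)"] by simp
qed

text \<open>Against even functions an integral over \<open>(-R, R)\<close> sees only the even part
  of a test function. Taking twice that part matches the folded integral over \<open>(0, R)\<close>
  without a factor.\<close>

lemma test_fun_symmetrize:
  assumes t: "test_fun R \<psi> \<psi>2"
  shows "test_fun R (\<lambda>x. \<psi> x + \<psi> (-x)) (\<lambda>x. \<psi>2 x + \<psi>2 (-x))"
proof -
  obtain \<psi>1 where d: "\<And>x. x \<in> {-R..R} \<Longrightarrow> (\<psi> has_real_derivative \<psi>1 x) (at x within {-R..R})"
    and i: "\<And>x. x \<in> {-R..R} \<Longrightarrow> \<psi>1 x = \<psi>1 (-R) + integral {-R..x} \<psi>2"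
    using test_fun_derivative[OF t] by blast
  note m = test_fun_second_derivative(1)[OF t] and b = test_fun_second_derivative(2)[OF t]
  show ?thesis
  proof (rule test_funI[where \<psi>'="\<lambda>x. \<psi>1 x - \<psi>1 (-x)"])
    show "(\<lambda>x. \<psi>2 x + \<psi>2 (-x)) \<in> borel_measurable (lebesgue_on {-R..R})"
      by (intro borel_measurable_add m measurable_reflect_interval)
    obtain C where C: "\<And>x. x \<in> {-R..R} \<Longrightarrow> norm (\<psi>2 x) \<le> C"
      using b unfolding bounded_iff by blast
    have "norm (\<psi>2 x + \<psi>2 (-x)) \<le> C + C" if "x \<in> {-R..R}" for x
      using C[OF that] C[of "-x"] that by (intro norm_triangle_mono) auto
    then show "bounded ((\<lambda>x. \<psi>2 x + \<psi>2 (-x)) ` {-R..R})"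
      unfolding bounded_iff by blast
  next
    fix x assume x: "x \<in> {-R..R}"
    show "((\<lambda>x. \<psi> x + \<psi> (-x)) has_real_derivative (\<psi>1 x - \<psi>1 (-x))) (at x within {-R..R})"
      using DERIV_add[OF d[OF x] has_derivative_reflect_interval[OF d x]] by simp
    have int: "\<psi>2 integrable_on {-R..R}"
      using test_fun_absolutely_integrable[OF t] by (rule set_lebesgue_integral_eq_integral(1))
    have i1: "\<psi>2 integrable_on {-R..x}" "\<psi>2 integrable_on {-x..R}"
      using x by (auto intro: integrable_on_subinterval[OF int])
    have "(\<lambda>x. \<psi>2 (-x)) integrable_on {-R..x}"
      using i1(2) Henstock_Kurzweil_Integration.integrable_reflect_real[where f=\<psi>2 and a="-x" and b=R] by simp
    then have "integral {-R..x} (\<lambda>x. \<psi>2 x + \<psi>2 (-x)) = integral {-R..x} \<psi>2 + integral {-R..x} (\<lambda>x. \<psi>2 (-x))"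
      by (intro Henstock_Kurzweil_Integration.integral_add i1)
    \<comment> \<open>After reflection the integral over \<open>[-x, R]\<close> is
      \<open>\<psi>1 R - \<psi>1 (-x)\<close>, which accounts for the second half of the derivative
      and for its value at \<open>-R\<close>.\<close>
    moreover have "integral {-R..x} (\<lambda>x. \<psi>2 (-x)) = integral {-x..R} \<psi>2"
      using Henstock_Kurzweil_Integration.integral_reflect_real[where f=\<psi>2 and a="-x" and b=R] by simp
    moreover have "integral {-R..-x} \<psi>2 + integral {-x..R} \<psi>2 = integral {-R..R} \<psi>2"
      using x by (intro Henstock_Kurzweil_Integration.integral_combine int) auto
    moreover have "\<psi>1 R = \<psi>1 (-R) + integral {-R..R} \<psi>2"
      using x by (intro i) auto
    moreover have "\<psi>1 (-x) = \<psi>1 (-R) + integral {-R..-x} \<psi>2"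
      using x by (intro i) auto
    ultimately show "\<psi>1 x - \<psi>1 (-x) = \<psi>1 (-R) - \<psi>1 (-(-R)) + integral {-R..x} (\<lambda>x. \<psi>2 x + \<psi>2 (-x))"
      using i[OF x] by simp
  qed (use test_fun_boundary[OF t] in simp_all)
qed

text \<open>The folded function q is even, so \<open>q' 0 = 0\<close> and \<open>q'\<close> is the
  integral of h from 0. Integrating once more back from \<open>q R = 0\<close> gives the
  representation in \<open>green_has_integral\<close>, up to sign.\<close>

lemma test_fun_green:
  assumes t: "test_fun R \<psi> \<psi>2" and x: "x \<in> {0..R}"
  shows "\<psi> x + \<psi> (-x) = - green R (\<lambda>s. \<psi>2 s + \<psi>2 (-s)) x"
proof -
  define h where "h = (\<lambda>s. \<psi>2 s + \<psi>2 (-s))"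
  define q where "q = (\<lambda>x. \<psi> x + \<psi> (-x))"
  have t': "test_fun R q h" unfolding h_def q_def by (rule test_fun_symmetrize[OF t])
  obtain q1 where d: "\<And>x. x \<in> {-R..R} \<Longrightarrow> (q has_real_derivative q1 x) (at x within {-R..R})"
    and i: "\<And>x. x \<in> {-R..R} \<Longrightarrow> q1 x = q1 (-R) + integral {-R..x} h"
    using test_fun_derivative[OF t'] by blast
  have int: "h integrable_on {-R..R}"
    using test_fun_absolutely_integrable[OF t'] by (rule set_lebesgue_integral_eq_integral(1))
  have q1_diff: "q1 y = q1 0 + integral {0..y} h" if "y \<in> {0..R}" for y
    using i[of y] i[of 0] that
      Henstock_Kurzweil_Integration.integral_combine[of "-R" 0 y h]
      integrable_on_subinterval[OF int, of "-R" y] by auto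
  have q1_0: "q1 0 = 0" if "R > 0"
  proof -
    have "(q has_real_derivative q1 0) (at 0)"
      using d[of 0] that by (auto simp: at_within_Icc_at)
    moreover from this have "((\<lambda>x. q (- x)) has_real_derivative - q1 0) (at 0)"
      using DERIV_mirror[of q "q1 0" 0] by simp
    moreover have "(\<lambda>x. q (- x)) = q" by (auto simp: q_def)
    ultimately have "q1 0 = - q1 0" using DERIV_unique by metis
    then show ?thesis by simp
  qed
  show ?thesis
  \<comment> \<open>Splitting off \<open>x = R\<close> leaves \<open>0 \<le> x < R\<close>, hence
    \<open>R > 0\<close>, so that 0 is an interior point and \<open>q1_0\<close> applies.\<close>
  proof (cases "x = R")
    case True
    have "green R h R = (\<integral>s. 0 \<partial>lebesgue_on {0<..<R})"
      unfolding green_def using x by (intro Bochner_Integration.integral_cong) auto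
    then show ?thesis using True test_fun_boundary[OF t] by (simp add: h_def)
  next
    case False
    then have R: "R > 0" using x by auto
    obtain C where C: "\<And>s. s \<in> {-R..R} \<Longrightarrow> norm (h s) \<le> C"
      using test_fun_second_derivative(2)[OF t'] unfolding bounded_iff by blast
    have "h \<in> borel_measurable (lebesgue_on {0<..<R})"
      using test_fun_second_derivative(1)[OF t'] by (rule measurable_restrict_mono) auto
    then have "weighted_integrable R h"
      by (rule bounded_weighted_integrable[where C=C]) (use C in auto)
    then have g: "((\<lambda>t. integral {0..t} h) has_integral green R h x) {x..R}"
      using x by (intro green_has_integral) auto
    have "(q1 has_integral (q R - q x)) {x..R}"
    proof (rule fundamental_theorem_of_calculus)
      show "(q has_vector_derivative q1 y) (at y within {x..R})" if "y \<in> {x..R}" for y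
        using d[of y] that x unfolding has_real_derivative_iff_has_vector_derivative
        by (auto intro: has_vector_derivative_within_subset)
    qed (use x in auto)
    then have "((\<lambda>t. integral {0..t} h) has_integral (q R - q x)) {x..R}"
      by (rule has_integral_eq[rotated]) (use q1_diff q1_0[OF R] x in auto)
    then have "q R - q x = green R h x" using g by (rule has_integral_unique)
    moreover have "q R = 0" by (rule test_fun_boundary(2)[OF t'])
    ultimately show ?thesis by (simp add: h_def q_def)
  qed
qed

text \<open>The derivative is continuous on a compact interval, hence bounded, and the mean value
  inequality is applied from the nearer endpoint, where \<psi> vanishes. This linear decay is what
  makes \<open>f * \<psi>\<close> integrable when f is controlled only by the weight.\<close>

lemma test_fun_bound:
  assumes t: "test_fun R \<psi> \<psi>2"
  obtains C where "\<And>x. x \<in> {-R..R} \<Longrightarrow> \<bar>\<psi> x\<bar> \<le> C * (R - \<bar>x\<bar>)"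
proof -
  obtain \<psi>1 where d: "\<And>x. x \<in> {-R..R} \<Longrightarrow> (\<psi> has_real_derivative \<psi>1 x) (at x within {-R..R})"
    and i: "\<And>x. x \<in> {-R..R} \<Longrightarrow> \<psi>1 x = \<psi>1 (-R) + integral {-R..x} \<psi>2"
    using test_fun_derivative[OF t] by blast
  have "\<psi>2 integrable_on {-R..R}"
    using test_fun_absolutely_integrable[OF t] by (rule set_lebesgue_integral_eq_integral(1))
  then have "continuous_on {-R..R} (\<lambda>x. \<psi>1 (-R) + integral {-R..x} \<psi>2)"
    by (intro continuous_intros indefinite_integral_continuous_1)
  then have "compact ((\<lambda>x. \<psi>1 (-R) + integral {-R..x} \<psi>2) ` {-R..R})"
    by (intro compact_continuous_image) auto
  then have "bounded ((\<lambda>x. \<psi>1 (-R) + integral {-R..x} \<psi>2) ` {-R..R})"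
    by (rule compact_imp_bounded)
  then obtain C where "\<forall>y\<in>(\<lambda>x. \<psi>1 (-R) + integral {-R..x} \<psi>2) ` {-R..R}. norm y \<le> C"
    unfolding bounded_iff by (rule exE)
  then have C: "norm (\<psi>1 (-R) + integral {-R..x} \<psi>2) \<le> C" if "x \<in> {-R..R}" for x
    using that by blast
  have C': "norm (\<psi>1 x) \<le> C" if "x \<in> {-R..R}" for x
    using C[OF that] i[OF that] by simp
  have "\<bar>\<psi> x\<bar> \<le> C * (R - \<bar>x\<bar>)" if x: "x \<in> {-R..R}" for x
  proof -
    have "norm (\<psi> x - \<psi> R) \<le> C * norm (x - R)" "norm (\<psi> x - \<psi> (-R)) \<le> C * norm (x - (-R))"
      using x by (intro field_differentiable_bound[OF _ d C']; simp)+
    then show ?thesis using x test_fun_boundary[OF t] by (cases "x \<ge> 0") (simp_all add: add.commute)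
  qed
  then show thesis by (rule that)
qed

lemma test_fun_continuous_on:
  assumes t: "test_fun R \<psi> \<psi>2"
  shows "continuous_on {-R..R} \<psi>"
proof -
  obtain \<psi>1 where d: "\<And>x. x \<in> {-R..R} \<Longrightarrow> (\<psi> has_real_derivative \<psi>1 x) (at x within {-R..R})"
    and "\<And>x. x \<in> {-R..R} \<Longrightarrow> \<psi>1 x = \<psi>1 (-R) + integral {-R..x} \<psi>2"
    using test_fun_derivative[OF t] by blast
  show ?thesis by (rule DERIV_continuous_on[OF d])
qed

section \<open>The potential as very weak solution; uniqueness and comparison\<close>

lemma integral_symmetric_interval:
  fixes g :: "real \<Rightarrow> real"
  assumes R: "0 \<le> R"
    and g: "g absolutely_integrable_on {0<..<R}" "(\<lambda>x. g (-x)) absolutely_integrable_on {0<..<R}"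
  shows "g absolutely_integrable_on {-R<..<R}"
    and "integral {-R<..<R} g = integral {0<..<R} (\<lambda>x. g x + g (-x))"
proof -
  have p: "g absolutely_integrable_on {0..R}" and m: "(\<lambda>x. g (-x)) absolutely_integrable_on {0..R}"
    using g by (simp_all add: absolutely_integrable_on_Icc_iff_Ioo)
  then have n: "g absolutely_integrable_on {-R..0}"
    using absolutely_integrable_reflect_real[where f=g and a="-R" and b=0] by simp
  have "g absolutely_integrable_on ({-R..0} \<union> {0..R})"
    using n p by (rule absolutely_integrable_Un)
  moreover have "{-R..0} \<union> {0..R} = {-R..R}" using R by auto
  ultimately have s: "g absolutely_integrable_on {-R..R}" by simp
  then show "g absolutely_integrable_on {-R<..<R}"
    by (simp add: absolutely_integrable_on_Icc_iff_Ioo)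
  have "integral {-R..R} g = integral {-R..0} g + integral {0..R} g"
    using R s by (intro Henstock_Kurzweil_Integration.integral_combine[symmetric]
        set_lebesgue_integral_eq_integral(1)) auto
  also have "integral {-R..0} g = integral {0..R} (\<lambda>x. g (-x))"
    using Henstock_Kurzweil_Integration.integral_reflect_real[where f=g and a="-R" and b=0] by simp
  also have "integral {0..R} (\<lambda>x. g (-x)) + integral {0..R} g = integral {0..R} (\<lambda>x. g x + g (-x))"
    using p m by (subst Henstock_Kurzweil_Integration.integral_add)
      (auto intro: set_lebesgue_integral_eq_integral(1))
  finally show "integral {-R<..<R} g = integral {0<..<R} (\<lambda>x. g x + g (-x))"
    by (simp add: integral_open_interval_real)
qed

lemma green_bounded_measurable:
  assumes "weighted_integrable R k"
  shows "green R k \<in> borel_measurable (lebesgue_on S)" "bounded (green R k ` {-R..R})"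
proof -
  show "green R k \<in> borel_measurable (lebesgue_on S)"
    by (intro borel_imp_lebesgue_on_measurable green_measurable assms)
  show "bounded (green R k ` {-R..R})"
    unfolding bounded_iff
    by (intro exI[of _ "\<integral>s. \<bar>k s * (R - s)\<bar> \<partial>lebesgue_on {0<..<R}"])
      (auto intro!: green_bound[OF assms])
qed

lemma green_absolutely_integrable:
  assumes "weighted_integrable R k"
  shows "green R k absolutely_integrable_on {-R<..<R}"
  using absolutely_integrable_bounded_on_interval[OF green_bounded_measurable[OF assms]]
  by (simp add: absolutely_integrable_on_Icc_iff_Ioo)

lemma absolutely_integrable_test_product:
  fixes u h :: "real \<Rightarrow> real"
  assumes u: "u absolutely_integrable_on {-R<..<R}"
    and h: "h \<in> borel_measurable (lebesgue_on {-R..R})" "bounded (h ` {-R..R})"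
  shows "(\<lambda>x. u x * h x) absolutely_integrable_on {-R<..<R}"
proof -
  have "(\<lambda>x. h x * u x) absolutely_integrable_on {-R..R}"
    using u h by (intro absolutely_integrable_bounded_measurable_product_real)
      (auto simp: absolutely_integrable_on_Icc_iff_Ioo)
  then show ?thesis by (simp add: absolutely_integrable_on_Icc_iff_Ioo mult.commute)
qed

text \<open>Both integrals are folded to \<open>(0, R)\<close>. There the folded test function is
  minus the potential of h, and \<open>integral_green_swap\<close> moves the potential from h onto
  f.\<close>

lemma green_is_very_weak_sol:
  assumes R: "R > 0" and f: "weighted_integrable R f" and even: "\<And>x. x \<in> {-R<..<R} \<Longrightarrow> f (-x) = f x"
    and t: "test_fun R \<psi> \<psi>2"
  shows "integral {-R<..<R} (\<lambda>x. f x * \<psi> x) = - integral {-R<..<R} (\<lambda>x. green R f x * \<psi>2 x)"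
proof -
  let ?M = "lebesgue_on {0<..<R}"
  note \<psi>2 = test_fun_second_derivative[OF t]
  define h where "h = (\<lambda>s. \<psi>2 s + \<psi>2 (-s))"
  have t': "test_fun R (\<lambda>x. \<psi> x + \<psi> (-x)) h"
    unfolding h_def by (rule test_fun_symmetrize[OF t])
  obtain B where B: "\<And>s. s \<in> {-R..R} \<Longrightarrow> norm (h s) \<le> B"
    using test_fun_second_derivative(2)[OF t'] unfolding bounded_iff by blast
  have hm: "h \<in> borel_measurable ?M"
    using test_fun_second_derivative(1)[OF t'] by (rule measurable_restrict_mono) auto
  obtain C where C: "\<And>x. x \<in> {-R..R} \<Longrightarrow> \<bar>\<psi> x\<bar> \<le> C * (R - \<bar>x\<bar>)"
    using test_fun_bound[OF t] by blast
  have \<psi>m: "\<psi> \<in> borel_measurable (lebesgue_on {-R..R})"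
    by (intro continuous_imp_measurable_on_sets_lebesgue test_fun_continuous_on[OF t]) auto
  have prod: "integrable ?M (\<lambda>x. f x * p x)"
    if p: "p \<in> borel_measurable (lebesgue_on {-R..R})"
      "\<And>x. x \<in> {0<..<R} \<Longrightarrow> \<bar>p x\<bar> \<le> C * (R - x)" for p
  proof (rule Bochner_Integration.integrable_bound)
    show "integrable ?M (\<lambda>x. C * (f x * (R - x)))" using f by (rule integrable_mult_right)
    have "p \<in> borel_measurable ?M" using p(1) by (rule measurable_restrict_mono) auto
    then show "(\<lambda>x. f x * p x) \<in> borel_measurable ?M"
      using weighted_integrable_measurable[OF f] by (rule borel_measurable_times[rotated])
    show "AE x in ?M. norm (f x * p x) \<le> norm (C * (f x * (R - x)))"
    proof (rule AE_I2)
      fix x assume "x \<in> space ?M"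
      then have "\<bar>p x\<bar> \<le> \<bar>C * (R - x)\<bar>" using p(2)[of x] by simp
      then have "\<bar>f x\<bar> * \<bar>p x\<bar> \<le> \<bar>f x\<bar> * \<bar>C * (R - x)\<bar>" by (rule mult_left_mono) simp
      then show "norm (f x * p x) \<le> norm (C * (f x * (R - x)))"
        by (simp add: abs_mult mult.left_commute)
    qed
  qed
  have "\<bar>\<psi> x\<bar> \<le> C * (R - x)" if "x \<in> {0<..<R}" for x
    using C[of x] that by simp
  then have i1: "integrable ?M (\<lambda>x. f x * \<psi> x)"
    by (intro prod \<psi>m)
  have "\<bar>\<psi> (-x)\<bar> \<le> C * (R - x)" if "x \<in> {0<..<R}" for x
    using C[of "-x"] that by simp
  then have i2: "integrable ?M (\<lambda>x. f x * \<psi> (-x))"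
    by (intro prod measurable_reflect_interval \<psi>m)
  have i2': "integrable ?M (\<lambda>x. f (-x) * \<psi> (-x))"
    by (rule Bochner_Integration.integrable_cong[THEN iffD1, OF refl _ i2]) (simp add: even)
  have "integral {-R<..<R} (\<lambda>x. f x * \<psi> x) = integral {0<..<R} (\<lambda>x. f x * \<psi> x + f (-x) * \<psi> (-x))"
    using R i1 i2' by (intro integral_symmetric_interval(2))
      (auto simp: absolutely_integrable_on_iff_integrable)
  also have "\<dots> = (\<integral>x. f x * \<psi> x + f (-x) * \<psi> (-x) \<partial>?M)"
    using i1 i2' by (intro lebesgue_integral_eq_integral[symmetric]) auto
  also have "\<dots> = (\<integral>x. - (f x * green R h x) \<partial>?M)"
  proof (rule Bochner_Integration.integral_cong)
    fix x assume "x \<in> space ?M"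
    then have x: "x \<in> {0<..<R}" by simp
    have "f x * \<psi> x + f (-x) * \<psi> (-x) = f x * (\<psi> x + \<psi> (-x))"
      using even[of x] x by (simp add: algebra_simps)
    also have "\<psi> x + \<psi> (-x) = - green R h x"
      unfolding h_def using x by (intro test_fun_green[OF t]) auto
    finally show "f x * \<psi> x + f (-x) * \<psi> (-x) = - (f x * green R h x)" by simp
  qed simp
  also have "\<dots> = - (\<integral>x. h x * green R f x \<partial>?M)"
    using integral_green_swap[OF f hm, of B] B by simp
  also have "(\<integral>x. h x * green R f x \<partial>?M) = integral {-R<..<R} (\<lambda>x. green R f x * \<psi>2 x)"
  proof -
    have ai: "(\<lambda>x. green R f x * \<psi>2 x) absolutely_integrable_on {0<..<R}"
      by (rule set_integrable_subset[OF absolutely_integrable_test_product[OF green_absolutely_integrable[OF f] \<psi>2]]) (use R in auto)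
    have "bounded ((\<lambda>x. \<psi>2 (- x)) ` {-R..R})"
      using \<psi>2(2) image_image[of \<psi>2 uminus "{-R..R}"] by simp
    then have "(\<lambda>x. green R f x * \<psi>2 (-x)) absolutely_integrable_on {-R<..<R}"
      by (intro absolutely_integrable_test_product green_absolutely_integrable f measurable_reflect_interval \<psi>2)
    then have ai': "(\<lambda>x. green R f (-x) * \<psi>2 (-x)) absolutely_integrable_on {0<..<R}"
      unfolding green_even by (rule set_integrable_subset) (use R in auto)
    have "integral {-R<..<R} (\<lambda>x. green R f x * \<psi>2 x)
        = integral {0<..<R} (\<lambda>x. green R f x * \<psi>2 x + green R f (-x) * \<psi>2 (-x))"
      using R by (intro integral_symmetric_interval(2) ai ai') auto
    also have "\<dots> = (\<integral>x. green R f x * \<psi>2 x + green R f (-x) * \<psi>2 (-x) \<partial>?M)"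
      using ai ai' by (intro lebesgue_integral_eq_integral[symmetric] Bochner_Integration.integrable_add)
        (auto simp: absolutely_integrable_on_iff_integrable)
    finally show ?thesis by (simp add: h_def algebra_simps)
  qed
  finally show ?thesis .
qed

lemma very_weak_sol_unique:
  assumes R: "R > 0" and f: "weighted_integrable R f" and even: "\<And>x. x \<in> {-R<..<R} \<Longrightarrow> f (-x) = f x"
    and u: "very_weak_sol R f u"
  shows "AE x in lborel. x \<in> {-R<..<R} \<longrightarrow> u x = green R f x"
proof -
  let ?D = "\<lambda>x. u x - green R f x"
  have ui: "u absolutely_integrable_on {-R<..<R}" using u by (simp add: very_weak_sol_def)
  have D: "?D absolutely_integrable_on {-R<..<R}"
    by (rule set_integral_diff(1)[OF ui green_absolutely_integrable[OF f]])
  then have "?D absolutely_integrable_on {-R..R}" by (simp add: absolutely_integrable_on_Icc_iff_Ioo)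
  then have Dm: "?D \<in> borel_measurable (lebesgue_on {-R..R})"
    by (simp add: absolutely_integrable_on_iff_integrable borel_measurable_integrable)
  have sm: "(\<lambda>x. sgn (?D x)) \<in> borel_measurable (lebesgue_on {-R..R})"
    by (rule measurable_compose[OF Dm]) simp
  have sb: "bounded ((\<lambda>x. sgn (?D x)) ` {-R..R})"
    unfolding bounded_iff by (intro exI[of _ 1]) (auto simp: sgn_if)
  obtain \<psi> where t: "test_fun R \<psi> (\<lambda>x. sgn (?D x))"
    by (rule test_fun_exists[OF R sm sb])
  have "- integral {-R<..<R} (\<lambda>x. u x * sgn (?D x)) = integral {-R<..<R} (\<lambda>x. f x * \<psi> x)"
    using u t unfolding very_weak_sol_def by blast
  then have "integral {-R<..<R} (\<lambda>x. u x * sgn (?D x)) = integral {-R<..<R} (\<lambda>x. green R f x * sgn (?D x))"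
    using green_is_very_weak_sol[OF R f even t] by simp
  then have "integral {-R<..<R} (\<lambda>x. u x * sgn (?D x) - green R f x * sgn (?D x)) = 0"
    using absolutely_integrable_test_product[OF ui sm sb]
      absolutely_integrable_test_product[OF green_absolutely_integrable[OF f] sm sb]
    by (subst Henstock_Kurzweil_Integration.integral_diff)
      (auto intro: set_lebesgue_integral_eq_integral(1))
  \<comment> \<open>The chosen second derivative turns the difference of the two identities into the
    L1 norm of \<open>u - green R f\<close>.\<close>
  moreover have "u x * sgn (?D x) - green R f x * sgn (?D x) = \<bar>?D x\<bar>" for x
    by (simp add: abs_sgn left_diff_distrib)
  ultimately have "integral {-R<..<R} (\<lambda>x. \<bar>?D x\<bar>) = 0" by simp
  moreover have Dabs: "integrable (lebesgue_on {-R<..<R}) (\<lambda>x. \<bar>?D x\<bar>)"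
    using D by (simp add: absolutely_integrable_on_iff_integrable)
  ultimately have "(\<integral>x. \<bar>?D x\<bar> \<partial>lebesgue_on {-R<..<R}) = 0"
    by (simp add: lebesgue_integral_eq_integral)
  then have "AE x in lebesgue_on {-R<..<R}. \<bar>?D x\<bar> = 0"
    using integral_nonneg_eq_0_iff_AE[OF Dabs] by simp
  then show ?thesis by (intro AE_lborel_on_iff[THEN iffD2]) simp_all
qed

text \<open>The test function is the potential of \<phi> itself, so its admissibility reduces to
  \<open>green R \<phi> \<ge> 0\<close>. A density \<phi> that changes sign is therefore allowed, as
  the endpoint estimate requires.\<close>

lemma supersol_compare:
  assumes R: "R > 0" and f: "weighted_integrable R f" and even: "\<And>x. x \<in> {-R<..<R} \<Longrightarrow> f (-x) = f x"
    and u: "very_weak_supersol R f u"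
    and \<phi>: "\<phi> \<in> borel_measurable (lebesgue_on {-R..R})" "bounded (\<phi> ` {-R..R})"
    and \<phi>_even: "\<And>x. \<phi> (-x) = \<phi> x"
    and pos: "\<And>x. x \<in> {0..R} \<Longrightarrow> green R \<phi> x \<ge> 0"
  shows "integral {-R<..<R} (\<lambda>x. (u x - green R f x) * \<phi> x) \<ge> 0"
proof -
  \<comment> \<open>The factor 1/2 undoes the doubling in \<open>test_fun_symmetrize\<close>; the
    sign makes the result the potential of \<phi> rather than its negative.\<close>
  have "(\<lambda>x. (- 1/2) * \<phi> x) \<in> borel_measurable (lebesgue_on {-R..R})"
    using \<phi>(1) by (intro borel_measurable_times) auto
  moreover have "bounded ((\<lambda>x. (- 1/2) * \<phi> x) ` {-R..R})"
    using bounded_scaling[OF \<phi>(2), of "-1/2"] by (simp add: image_image)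
  ultimately obtain \<psi>0 where "test_fun R \<psi>0 (\<lambda>x. (- 1/2) * \<phi> x)"
    by (rule test_fun_exists[OF R])
  note t0 = this
  let ?\<psi> = "\<lambda>x. \<psi>0 x + \<psi>0 (-x)"
  have t: "test_fun R ?\<psi> (\<lambda>x. - \<phi> x)"
    using test_fun_symmetrize[OF t0] by (simp add: \<phi>_even)
  have \<psi>_green: "?\<psi> x = green R \<phi> x" if "x \<in> {0..R}" for x
    using test_fun_green[OF t0 that] by (simp add: \<phi>_even green_def)
  have "?\<psi> x \<ge> 0" if "x \<in> {-R<..<R}" for x
  proof (cases "x \<ge> 0")
    case True then show ?thesis using \<psi>_green[of x] pos[of x] that by simp
  next
    case False then show ?thesis using \<psi>_green[of "-x"] pos[of "-x"] that by simp
  qed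
  then have "integral {-R<..<R} (\<lambda>x. f x * ?\<psi> x) \<le> - integral {-R<..<R} (\<lambda>x. u x * - \<phi> x)"
    using u t unfolding very_weak_supersol_def by blast
  then have "integral {-R<..<R} (\<lambda>x. green R f x * \<phi> x) \<le> integral {-R<..<R} (\<lambda>x. u x * \<phi> x)"
    using green_is_very_weak_sol[OF R f even t] by simp
  moreover have "u absolutely_integrable_on {-R<..<R}" using u by (simp add: very_weak_supersol_def)
  ultimately show ?thesis
    unfolding left_diff_distrib using f \<phi>
    by (subst Henstock_Kurzweil_Integration.integral_diff)
      (auto intro!: set_lebesgue_integral_eq_integral(1) absolutely_integrable_test_product green_absolutely_integrable)
qed

lemma supersol_ge_green:
  assumes R: "R > 0" and f: "weighted_integrable R f" and even: "\<And>x. x \<in> {-R<..<R} \<Longrightarrow> f (-x) = f x"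
    and u: "very_weak_supersol R f u" and u_even: "\<And>x. x \<in> {-R<..<R} \<Longrightarrow> u (-x) = u x"
  shows "AE x in lborel. x \<in> {-R<..<R} \<longrightarrow> u x \<ge> green R f x"
proof -
  let ?D = "\<lambda>x. u x - green R f x"
  let ?S = "{-R<..<R}"
  have ui: "u absolutely_integrable_on ?S" using u by (simp add: very_weak_supersol_def)
  have D: "?D absolutely_integrable_on ?S"
    by (rule set_integral_diff(1)[OF ui green_absolutely_integrable[OF f]])
  then have Di: "integrable (lebesgue_on ?S) ?D"
    by (simp add: absolutely_integrable_on_iff_integrable)
  \<comment> \<open>The cutoff to the open interval makes \<phi> even on the whole line, although u
    is known to be even only inside.\<close>
  define \<phi> where "\<phi> = (\<lambda>x. if x \<in> ?S then if ?D x < 0 then 1 else 0 else 0 :: real)"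
  have "(\<lambda>x. if ?D x < 0 then 1 else 0 :: real) \<in> borel_measurable (lebesgue_on ?S)"
    by (rule measurable_compose[OF borel_measurable_integrable[OF Di],
          of "\<lambda>y. if y < 0 then 1 else 0 :: real"]) measurable
  then have "\<phi> \<in> borel_measurable lebesgue"
    unfolding \<phi>_def by (subst borel_measurable_if) auto
  then have \<phi>m: "\<phi> \<in> borel_measurable (lebesgue_on {-R..R})"
    by (rule measurable_restrict_space1)
  have \<phi>b: "bounded (\<phi> ` {-R..R})"
    unfolding bounded_iff by (intro exI[of _ 1]) (auto simp: \<phi>_def)
  have \<phi>_even: "\<phi> (-x) = \<phi> x" for x
    using u_even[of x] by (auto simp: \<phi>_def)
  have pos: "green R \<phi> x \<ge> 0" if "x \<in> {0..R}" for x
    unfolding green_def using that by (intro Bochner_Integration.integral_nonneg) (auto simp: \<phi>_def)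
  have ge: "integral ?S (\<lambda>x. ?D x * \<phi> x) \<ge> 0"
    by (rule supersol_compare[OF R f even u \<phi>m \<phi>b \<phi>_even pos])
  have "(\<lambda>x. ?D x * \<phi> x) absolutely_integrable_on ?S"
    by (rule absolutely_integrable_test_product[OF D \<phi>m \<phi>b])
  then have i: "integrable (lebesgue_on ?S) (\<lambda>x. - (?D x * \<phi> x))"
    by (simp add: absolutely_integrable_on_iff_integrable)
  \<comment> \<open>\<open>?D x * \<phi> x\<close> is minus the negative part of
    \<open>?D x\<close>, so its integral is at most 0; the comparison gives at least 0, and the
    negative part vanishes a.e.\<close>
  have nn: "0 \<le> - (?D x * \<phi> x)" for x by (auto simp: \<phi>_def)
  have "(\<integral>x. - (?D x * \<phi> x) \<partial>lebesgue_on ?S) = - integral ?S (\<lambda>x. ?D x * \<phi> x)"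
    using lebesgue_integral_eq_integral[OF i] by simp
  moreover have "0 \<le> (\<integral>x. - (?D x * \<phi> x) \<partial>lebesgue_on ?S)"
    by (rule Bochner_Integration.integral_nonneg) (rule nn)
  ultimately have "(\<integral>x. - (?D x * \<phi> x) \<partial>lebesgue_on ?S) = 0" using ge by linarith
  then have "AE x in lebesgue_on ?S. - (?D x * \<phi> x) = 0"
    using integral_nonneg_eq_0_iff_AE[OF i] nn by simp
  then have "AE x in lborel. x \<in> ?S \<longrightarrow> - (?D x * \<phi> x) = 0"
    by (intro AE_lborel_on_iff[THEN iffD2]) simp_all
  then show ?thesis
    by eventually_elim (auto simp: \<phi>_def split: if_splits)
qed

section \<open>Shape of the potential under the sign condition\<close>

text \<open>Mass at \<open>s \<ge> r0\<close> contributes with the factor \<open>R - s\<close> at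
  both points, so only the region where \<open>f \<ge> 0\<close> makes a difference, and there the
  kernel decreases in x.\<close>

lemma green_antimono_inner:
  assumes f: "weighted_integrable R f"
    and pos: "AE s in lebesgue_on {0<..<R}. s < r0 \<longrightarrow> f s \<ge> 0"
    and x: "0 \<le> x" "x \<le> y" "y \<le> r0" "r0 \<le> R"
  shows "green R f y \<le> green R f x"
  unfolding green_def
proof (rule integral_mono_AE)
  show "AE s in lebesgue_on {0<..<R}. f s * (R - max s \<bar>y\<bar>) \<le> f s * (R - max s \<bar>x\<bar>)"
    using pos
  proof eventually_elim
    fix s assume "s < r0 \<longrightarrow> 0 \<le> f s"
    then show "f s * (R - max s \<bar>y\<bar>) \<le> f s * (R - max s \<bar>x\<bar>)"
      using x by (cases "s < r0") (auto intro!: mult_left_mono)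
  qed
qed (rule green_integrable[OF f]; use x in simp)+

text \<open>Convexity of the potential on \<open>[r0, R]\<close>, together with its zero at \<open>R\<close>.\<close>

lemma green_ratio_antimono:
  assumes f: "weighted_integrable R f"
    and neg: "AE s in lebesgue_on {0<..<R}. r0 < s \<longrightarrow> f s \<le> 0"
    and x: "0 \<le> r0" "r0 \<le> x" "x \<le> y" "y \<le> R"
  shows "(R - x) * green R f y \<le> (R - y) * green R f x"
proof -
  have "(\<integral>s. (R - x) * (f s * (R - max s \<bar>y\<bar>)) \<partial>lebesgue_on {0<..<R})
      \<le> (\<integral>s. (R - y) * (f s * (R - max s \<bar>x\<bar>)) \<partial>lebesgue_on {0<..<R})"
  proof (rule integral_mono_AE)
    show "AE s in lebesgue_on {0<..<R}.
        (R - x) * (f s * (R - max s \<bar>y\<bar>)) \<le> (R - y) * (f s * (R - max s \<bar>x\<bar>))"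
      using neg AE_space
    proof eventually_elim
      fix s assume s: "r0 < s \<longrightarrow> f s \<le> 0" "s \<in> space (lebesgue_on {0<..<R})"
      \<comment> \<open>For \<open>s \<le> x\<close> both sides equal
        \<open>f s * (R - x) * (R - y)\<close>, so the mass inside \<open>r0\<close> cancels. In the
        other two cases \<open>s > r0\<close>, hence \<open>f s \<le> 0\<close>.\<close>
      consider "s \<le> x" | "x < s" "s \<le> y" | "y < s" by linarith
      then show "(R - x) * (f s * (R - max s \<bar>y\<bar>)) \<le> (R - y) * (f s * (R - max s \<bar>x\<bar>))"
      proof cases
        case 1
        then show ?thesis using x by (simp add: max_def)
      next
        case 2
        then have "f s * (R - x) \<le> f s * (R - s)"
          using s x by (intro mult_left_mono_neg) auto
        then have "(R - y) * (f s * (R - x)) \<le> (R - y) * (f s * (R - s))"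
          using x by (intro mult_left_mono[of "f s * (R - x)"]) simp_all
        moreover have "max s \<bar>y\<bar> = y" "max s \<bar>x\<bar> = s" using 2 x by auto
        ultimately show ?thesis by (simp only: mult_ac)
      next
        case 3
        have "(f s * (R - s)) * (R - x) \<le> (f s * (R - s)) * (R - y)"
          using s x 3 by (intro mult_left_mono_neg mult_nonpos_nonneg) auto
        moreover have "max s \<bar>y\<bar> = s" "max s \<bar>x\<bar> = s" using 3 x by auto
        ultimately show ?thesis by (simp only: mult_ac)
      qed
    qed
  qed (rule integrable_mult_right, rule green_integrable[OF f]; use x in simp)+
  then show ?thesis by (simp add: green_def)
qed

text \<open>The graph lies below the chord to the zero at R, and a chord starting at a nonnegative
  value does not rise.\<close>

lemma green_antimono_outer:
  assumes f: "weighted_integrable R f"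
    and neg: "AE s in lebesgue_on {0<..<R}. r0 < s \<longrightarrow> f s \<le> 0"
    and x: "0 \<le> r0" "r0 \<le> x" "x \<le> y" "y \<le> R" "x < R"
    and pos: "green R f x \<ge> 0"
  shows "green R f y \<le> green R f x"
proof -
  have "(R - x) * green R f y \<le> (R - y) * green R f x"
    by (rule green_ratio_antimono[OF f neg x(1-4)])
  also have "\<dots> \<le> (R - x) * green R f x"
    using x pos by (intro mult_right_mono) auto
  finally show ?thesis using x by simp
qed

section \<open>Splitting f at r0: balance and decay as values of the potential\<close>

lemma weighted_integrable_bound:
  assumes f: "weighted_integrable R f"
    and g: "g \<in> borel_measurable (lebesgue_on {0<..<R})"
    and le: "\<And>s. s \<in> {0<..<R} \<Longrightarrow> \<bar>g s\<bar> \<le> \<bar>f s\<bar>"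
  shows "weighted_integrable R g"
proof (rule Bochner_Integration.integrable_bound[OF f])
  have "(\<lambda>s. R - s) \<in> borel_measurable (lebesgue_on {0<..<R})"
    by (rule borel_imp_lebesgue_on_measurable) simp
  with g show "(\<lambda>s. g s * (R - s)) \<in> borel_measurable (lebesgue_on {0<..<R})"
    by (rule borel_measurable_times)
  show "AE s in lebesgue_on {0<..<R}. norm (g s * (R - s)) \<le> norm (f s * (R - s))"
    using le by (auto intro!: mult_right_mono simp: abs_mult)
qed

text \<open>The cutoffs here and in \<open>outer_part\<close> are set memberships so that
  \<open>integral_restrict_Int\<close> applies. Both parts are 0 at \<open>r0\<close>, and their
  difference recovers f only a.e., through the sign conditions.\<close>

definition inner_part :: "real \<Rightarrow> (real \<Rightarrow> real) \<Rightarrow> real \<Rightarrow> real" where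
  "inner_part r0 f s = (if s \<in> {..<r0} then fplus f s else 0)"

definition outer_part :: "real \<Rightarrow> (real \<Rightarrow> real) \<Rightarrow> real \<Rightarrow> real" where
  "outer_part r0 f s = (if s \<in> {r0<..} then fminus f s else 0)"

lemma weighted_integrable_parts:
  assumes f: "weighted_integrable R f"
  shows "weighted_integrable R (inner_part r0 f)" "weighted_integrable R (outer_part r0 f)"
proof -
  note [measurable] = weighted_integrable_measurable[OF f]
  have [measurable]: "(\<lambda>x. x) \<in> borel_measurable (lebesgue_on {0<..<R})"
    by (rule borel_imp_lebesgue_on_measurable) simp
  have "inner_part r0 f \<in> borel_measurable (lebesgue_on {0<..<R})"
    unfolding inner_part_def[abs_def] fplus_def lessThan_iff by measurable
  then show "weighted_integrable R (inner_part r0 f)"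
    by (rule weighted_integrable_bound[OF f]) (auto simp: inner_part_def fplus_def)
  have "outer_part r0 f \<in> borel_measurable (lebesgue_on {0<..<R})"
    unfolding outer_part_def[abs_def] fminus_def greaterThan_iff by measurable
  then show "weighted_integrable R (outer_part r0 f)"
    by (rule weighted_integrable_bound[OF f]) (auto simp: outer_part_def fminus_def)
qed

text \<open>Where \<open>inner_part\<close> is nonzero the weight is at least \<open>R - r0\<close>,
  so the unweighted integral is finite too.\<close>

lemma fplus_integrable_inner:
  assumes f: "weighted_integrable R f" and r0: "0 < r0" "r0 < R"
  shows "integrable (lebesgue_on {0<..<R}) (inner_part r0 f)"
    and "(\<integral>s. inner_part r0 f s \<partial>lebesgue_on {0<..<R}) = integral {0<..<r0} (fplus f)"
proof -
  note w = weighted_integrable_parts(1)[OF f, of r0]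
  show i: "integrable (lebesgue_on {0<..<R}) (inner_part r0 f)"
  proof (rule Bochner_Integration.integrable_bound)
    show "integrable (lebesgue_on {0<..<R}) (\<lambda>s. inverse (R - r0) * (inner_part r0 f s * (R - s)))"
      using w by (rule integrable_mult_right)
    show "inner_part r0 f \<in> borel_measurable (lebesgue_on {0<..<R})"
      by (rule weighted_integrable_measurable[OF w])
    show "AE s in lebesgue_on {0<..<R}. norm (inner_part r0 f s)
        \<le> norm (inverse (R - r0) * (inner_part r0 f s * (R - s)))"
    proof (rule AE_I2)
      fix s
      have "\<bar>inner_part r0 f s\<bar> * (R - r0) \<le> \<bar>inner_part r0 f s\<bar> * \<bar>R - s\<bar>"
        using r0 by (cases "s < r0") (auto intro!: mult_left_mono simp: inner_part_def)
      then show "norm (inner_part r0 f s) \<le> norm (inverse (R - r0) * (inner_part r0 f s * (R - s)))"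
        using r0 by (simp add: abs_mult pos_le_divide_eq flip: divide_inverse_commute)
    qed
  qed
  have "(\<integral>s. inner_part r0 f s \<partial>lebesgue_on {0<..<R}) = integral {0<..<R} (inner_part r0 f)"
    by (rule lebesgue_integral_eq_integral[OF i]) simp
  also have "\<dots> = integral ({..<r0} \<inter> {0<..<R}) (fplus f)"
    unfolding inner_part_def[abs_def] by (rule Henstock_Kurzweil_Integration.integral_restrict_Int)
  also have "{..<r0} \<inter> {0<..<R} = {0<..<r0}" using r0 by auto
  finally show "(\<integral>s. inner_part r0 f s \<partial>lebesgue_on {0<..<R}) = integral {0<..<r0} (fplus f)" .
qed

lemma AE_split:
  assumes pos: "AE s in lebesgue_on {0<..<R}. s < r0 \<longrightarrow> f s \<ge> 0"
    and neg: "AE s in lebesgue_on {0<..<R}. r0 < s \<longrightarrow> f s \<le> 0"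
  shows "AE s in lebesgue_on {0<..<R}. f s = inner_part r0 f s - outer_part r0 f s"
proof -
  \<comment> \<open>No sign is prescribed at \<open>r0\<close>, where both parts vanish; the point
    is discarded as a null set.\<close>
  have "AE s in lborel. s \<noteq> r0" by (rule AE_lborel_singleton)
  then have "AE s in lborel. s \<in> {0<..<R} \<longrightarrow> s \<noteq> r0" by eventually_elim simp
  then have "AE s in lebesgue_on {0<..<R}. s \<noteq> r0"
    by (intro AE_lborel_on_iff[THEN iffD1]) simp_all
  with pos neg show ?thesis
    by eventually_elim (auto simp: inner_part_def outer_part_def fplus_def fminus_def)
qed

text \<open>Seen from \<open>r \<ge> r0\<close>, all inner mass has the same kernel value
  \<open>R - r\<close> and acts only through its total.\<close>

lemma green_outer_formula:
  assumes f: "weighted_integrable R f" and r0: "0 < r0" "r0 < R"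
    and pos: "AE s in lebesgue_on {0<..<R}. s < r0 \<longrightarrow> f s \<ge> 0"
    and neg: "AE s in lebesgue_on {0<..<R}. r0 < s \<longrightarrow> f s \<le> 0"
    and r: "r0 \<le> r" "r \<le> R"
  shows "green R f r = (R - r) * integral {0<..<r0} (fplus f) - green R (outer_part r0 f) r"
proof -
  note w = weighted_integrable_parts[OF f, of r0]
  have "green R f r = (\<integral>s. inner_part r0 f s * (R - max s \<bar>r\<bar>) - outer_part r0 f s * (R - max s \<bar>r\<bar>)
      \<partial>lebesgue_on {0<..<R})"
    unfolding green_def
  proof (rule integral_cong_AE)
    show "AE s in lebesgue_on {0<..<R}. f s * (R - max s \<bar>r\<bar>)
        = inner_part r0 f s * (R - max s \<bar>r\<bar>) - outer_part r0 f s * (R - max s \<bar>r\<bar>)"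
      using AE_split[OF pos neg] by eventually_elim (simp add: left_diff_distrib)
  qed (intro borel_measurable_diff borel_measurable_integrable green_integrable f w; use r r0 in simp)+
  also have "\<dots> = green R (inner_part r0 f) r - green R (outer_part r0 f) r"
    unfolding green_def using r r0
    by (intro Bochner_Integration.integral_diff green_integrable w) auto
  also have "green R (inner_part r0 f) r = (\<integral>s. (R - r) * inner_part r0 f s \<partial>lebesgue_on {0<..<R})"
    unfolding green_def using r r0
    by (intro Bochner_Integration.integral_cong) (auto simp: inner_part_def max_def)
  also have "\<dots> = (R - r) * integral {0<..<r0} (fplus f)"
    using fplus_integrable_inner(2)[OF f r0] by simp
  finally show ?thesis .
qed

lemma integral_outer_part:
  assumes "0 < r0"
  shows "integral {0..t} (outer_part r0 f) = integral {r0<..<t} (fminus f)"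
proof -
  have "integral {0..t} (outer_part r0 f) = integral {0<..<t} (outer_part r0 f)"
    by (rule integral_open_interval_real)
  also have "\<dots> = integral ({r0<..} \<inter> {0<..<t}) (fminus f)"
    unfolding outer_part_def[abs_def] by (rule Henstock_Kurzweil_Integration.integral_restrict_Int)
  also have "{r0<..} \<inter> {0<..<t} = {r0<..<t}" using assms by auto
  finally show ?thesis .
qed

text \<open>With \<open>green_outer_formula\<close> this identifies the iterated integral of the
  decay condition; \<open>green_outer_part_at\<close> does the same for the balance condition, since
  at \<open>r0\<close> the kernel on the outer part is the weight \<open>R - s\<close>.\<close>

lemma green_outer_part:
  assumes f: "weighted_integrable R f" and r0: "0 < r0" and r: "0 \<le> r" "r \<le> R"
  shows "green R (outer_part r0 f) r = integral {r<..<R} (\<lambda>t. integral {r0<..<t} (fminus f))"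
  using integral_unique[OF green_has_integral[OF weighted_integrable_parts(2)[OF f, of r0] r]]
  unfolding integral_outer_part[OF r0] by (simp add: integral_open_interval_real)

lemma green_outer_part_at:
  assumes f: "weighted_integrable R f" and r0: "0 < r0" "r0 < R"
  shows "green R (outer_part r0 f) r0 = integral {r0<..<R} (\<lambda>s. fminus f s * (R - s))"
proof -
  have "green R (outer_part r0 f) r0 = integral {0<..<R} (\<lambda>s. outer_part r0 f s * (R - max s \<bar>r0\<bar>))"
    unfolding green_def using r0
    by (intro lebesgue_integral_eq_integral green_integrable weighted_integrable_parts f) auto
  also have "\<dots> = integral {0<..<R} (\<lambda>s. if s \<in> {r0<..} then fminus f s * (R - s) else 0)"
    using r0 by (intro Henstock_Kurzweil_Integration.integral_cong) (auto simp: outer_part_def max_def)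
  also have "\<dots> = integral ({r0<..} \<inter> {0<..<R}) (\<lambda>s. fminus f s * (R - s))"
    by (rule Henstock_Kurzweil_Integration.integral_restrict_Int)
  also have "{r0<..} \<inter> {0<..<R} = {r0<..<R}" using r0 by auto
  finally show ?thesis .
qed

section \<open>C1 regularity and the slope at the endpoint\<close>

text \<open>The formula with the integral of F from x to R is available only for
  \<open>x \<ge> 0\<close>. Replacing F by its odd extension G, continuous because
  \<open>F 0 = 0\<close>, makes it hold on all of \<open>[-R, R]\<close>: G integrates to 0 over
  \<open>[x, -x]\<close>. One application of the fundamental theorem then covers 0 and both
  endpoints.\<close>

lemma C1_on_green:
  assumes R: "R > 0" and f: "weighted_integrable R f" and int: "f integrable_on {0..R}"
  defines "F \<equiv> \<lambda>t. integral {0..t} f"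
  shows "C1_on R (green R f) (\<lambda>x. F (max (-x) 0) - F (max x 0))"
proof -
  define G where "G = (\<lambda>t. F (max t 0) - F (max (-t) 0))"
  have F0: "F 0 = 0" by (simp add: F_def)
  have Fc: "continuous_on {0..R} F"
    unfolding F_def by (rule indefinite_integral_continuous_1[OF int])
  have "continuous_on {-R..R} (\<lambda>t. F (max t 0))" "continuous_on {-R..R} (\<lambda>t. F (max (-t) 0))"
    using R by (auto intro!: continuous_on_compose2[OF Fc] continuous_intros)
  then have Gc: "continuous_on {-R..R} G"
    unfolding G_def by (rule continuous_on_diff)
  have pos: "green R f x = integral {x..R} G" if x: "x \<in> {0..R}" for x
  proof -
    have "(F has_integral green R f x) {x..R}"
      unfolding F_def using x by (intro green_has_integral f) auto
    moreover have "F t = G t" if "t \<in> {x..R}" for t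
      using x F0 that by (cases "t = 0") (auto simp: G_def max_def)
    ultimately have "(G has_integral green R f x) {x..R}"
      by (rule has_integral_eq[rotated])
    then show ?thesis by (rule integral_unique[symmetric])
  qed
  have green_G: "green R f x = integral {x..R} G" if x: "x \<in> {-R..R}" for x
  proof (cases "x \<ge> 0")
    case True
    then show ?thesis using pos x by auto
  next
    case False
    have "integral {x..- x} G = integral {x..- x} (\<lambda>t. G (- t))"
      using Henstock_Kurzweil_Integration.integral_reflect_real[where f=G and a=x and b="-x"] by simp
    also have "\<dots> = integral {x..- x} (\<lambda>t. - G t)" by (simp add: G_def)
    finally have "integral {x..- x} G = 0" by simp
    moreover have "integral {x..- x} G + integral {- x..R} G = integral {x..R} G"
      using x False
      by (intro Henstock_Kurzweil_Integration.integral_combine integrable_continuous_real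
          continuous_on_subset[OF Gc]) auto
    ultimately show ?thesis using pos[of "-x"] x False by simp
  qed
  have "(green R f has_real_derivative - G x) (at x within {-R..R})" if x: "x \<in> {-R..R}" for x
    using integral_has_real_derivative'[OF Gc x] unfolding has_field_derivative_def
    by (rule has_derivative_transform[OF x, rotated]) (rule green_G)
  moreover have "- G x = F (max (-x) 0) - F (max x 0)" for x by (simp add: G_def)
  moreover have "continuous_on {-R..R} (\<lambda>x. - G x)" by (intro continuous_intros Gc)
  ultimately show ?thesis unfolding C1_on_def by simp
qed

lemma AE_not_in_interval_imp_le:
  fixes a b :: real
  assumes "AE x in lborel. x \<notin> {a<..<b}"
  shows "b \<le> a"
proof (rule ccontr)
  assume ab: "\<not> b \<le> a"
  have "{a<..<b} \<in> null_sets lborel"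
    using assms by (subst AE_iff_null_sets) simp_all
  then have "emeasure lborel {a<..<b} = 0" by (rule null_setsD1)
  then show False using ab by simp
qed

text \<open>Test function with \<open>\<psi>'' = -1\<close> on \<open>a \<le> \<bar>x\<bar> < c\<close> and \<open>\<psi>'' = 1\<close> on
  \<open>c \<le> \<bar>x\<bar> \<le> R\<close>, where \<open>c\<close> is the midpoint of \<open>[a, R]\<close>: it detects an increase of \<open>u - green R f\<close>
  near the endpoint.\<close>

lemma supersol_C1_endpoint:
  assumes R: "R > 0" and f: "weighted_integrable R f" and even: "\<And>x. x \<in> {-R<..<R} \<Longrightarrow> f (-x) = f x"
    and u: "very_weak_supersol R f u" and u_even: "\<And>x. x \<in> {-R<..<R} \<Longrightarrow> u (-x) = u x"
    and r0: "0 \<le> r0" "r0 < R"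
    and anti: "\<And>x y. r0 < x \<Longrightarrow> x \<le> y \<Longrightarrow> y < R \<Longrightarrow> green R f y \<le> green R f x"
    and uv: "AE x in lborel. x \<in> {-R<..<R} \<longrightarrow> u x = v x"
    and C1: "C1_on R v v'"
  shows "v' R \<le> 0"
proof (rule ccontr)
  assume "\<not> v' R \<le> 0"
  then have vR: "v' R > 0" by simp
  have v'c: "continuous_on {-R..R} v'"
    and vd: "\<And>x. x \<in> {-R..R} \<Longrightarrow> (v has_real_derivative v' x) (at x within {-R..R})"
    using C1 by (auto simp: C1_on_def)
  obtain d where d: "d > 0" "\<And>x. x \<in> {-R..R} \<Longrightarrow> dist x R < d \<Longrightarrow> dist (v' x) (v' R) < v' R"
    using v'c[unfolded continuous_on_iff, rule_format, of R "v' R"] vR R by auto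
  \<comment> \<open>The first term keeps a beyond \<open>r0\<close>, where the potential is
    nonincreasing; the second keeps \<open>[a, R]\<close> within the range where \<open>v'\<close>
    is positive.\<close>
  define a where "a = max ((r0 + R) / 2) (R - d / 2)"
  have a: "r0 < a" "a < R" "R - a < d" using r0 d by (auto simp: a_def max_def field_simps)
  have v'_pos: "v' x > 0" if "x \<in> {a..R}" for x
    using d(2)[of x] that a r0 by (auto simp: dist_real_def)
  have v_mono: "v x < v y" if "a \<le> x" "x < y" "y \<le> R" for x y
  proof (rule DERIV_pos_imp_increasing_open[OF that(2)])
    fix z assume z: "x < z" "z < y"
    then have "(v has_real_derivative v' z) (at z)"
      using vd[of z] that a r0 at_within_Icc_at[of "-R" z R] by simp
    then show "\<exists>w. (v has_real_derivative w) (at z) \<and> 0 < w"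
      using v'_pos[of z] that z by auto
  next
    have "continuous_on {-R..R} v" by (rule DERIV_continuous_on[OF vd])
    then show "continuous_on {x..y} v"
      by (rule continuous_on_subset) (use that a r0 in auto)
  qed
  let ?M = "lebesgue_on {0<..<R}"
  interpret M: finite_measure ?M
    by (rule finite_measure_lebesgue_on) auto
  define c where "c = (a + R) / 2"
  have c: "a < c" "c < R" "c - a = R - c" using a by (auto simp: c_def field_simps)
  define \<phi> :: "real \<Rightarrow> real" where
    "\<phi> = (\<lambda>x. if \<bar>x\<bar> < a then 0 else if \<bar>x\<bar> < c then 1 else -1)"
  have \<phi>b: "\<phi> \<in> borel_measurable borel" unfolding \<phi>_def by measurable
  have \<phi>m: "\<phi> \<in> borel_measurable (lebesgue_on S)" for S
    by (rule borel_imp_lebesgue_on_measurable[OF \<phi>b])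
  have \<phi>bd: "bounded (\<phi> ` {-R..R})"
    unfolding bounded_iff by (intro exI[of _ 1]) (auto simp: \<phi>_def)
  have \<phi>i: "integrable ?M \<phi>"
    by (rule M.integrable_const_bound[where B=1]) (auto simp: \<phi>_def intro!: \<phi>m[unfolded \<phi>_def])
  have \<phi>0: "(\<integral>s. \<phi> s \<partial>?M) = 0"
  proof -
    have ind: "integrable ?M (indicator {p..<q} :: real \<Rightarrow> real)" for p q
      by (rule M.integrable_const_bound[where B=1])
        (auto intro!: borel_imp_lebesgue_on_measurable AE_I2)
    have "(\<integral>s. \<phi> s \<partial>?M) = (\<integral>s. indicator {a..<c} s - indicator {c..<R} s \<partial>?M)"
      using a r0 c by (intro Bochner_Integration.integral_cong) (auto simp: \<phi>_def indicator_def)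
    also have "\<dots> = (\<integral>s. indicator {a..<c} s \<partial>?M) - (\<integral>s. indicator {c..<R} s \<partial>?M)"
      by (intro Bochner_Integration.integral_diff ind)
    also have "\<dots> = measure ?M {a..<c} - measure ?M {c..<R}"
      using a r0 c by (simp add: Int_absorb2 subset_eq)
    also have "\<dots> = 0"
      using a r0 c by (simp add: measure_restrict_space subset_eq)
    finally show ?thesis .
  qed
  have \<phi>w: "weighted_integrable R \<phi>"
    by (rule bounded_weighted_integrable[where C=1, OF \<phi>m]) (auto simp: \<phi>_def)
  have pos: "green R \<phi> x \<ge> 0" if x: "x \<in> {0..R}" for x
  proof -
    \<comment> \<open>As \<phi> has mean 0, a kernel constant in s integrates to 0. The true kernel
      decreases in s, so it exceeds its value at c where \<phi> is 1 and falls below it where \<phi>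
      is -1.\<close>
    have "(\<integral>s. \<phi> s * (R - max c \<bar>x\<bar>) \<partial>?M) \<le> green R \<phi> x"
      unfolding green_def
    proof (rule integral_mono_AE)
      show "AE s in ?M. \<phi> s * (R - max c \<bar>x\<bar>) \<le> \<phi> s * (R - max s \<bar>x\<bar>)"
        by (intro AE_I2) (auto simp: \<phi>_def)
      show "integrable ?M (\<lambda>s. \<phi> s * (R - max s \<bar>x\<bar>))"
        using x by (intro green_integrable \<phi>w) auto
      show "integrable ?M (\<lambda>s. \<phi> s * (R - max c \<bar>x\<bar>))"
        by (rule integrable_mult_left) (rule \<phi>i)
    qed
    then show ?thesis using \<phi>0 by simp
  qed
  let ?D = "\<lambda>x. u x - green R f x"
  have ui: "u absolutely_integrable_on {-R<..<R}" using u by (simp add: very_weak_supersol_def)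
  have D: "?D absolutely_integrable_on {-R<..<R}"
    by (rule set_integral_diff(1)[OF ui green_absolutely_integrable[OF f]])
  have whole: "integral {-R<..<R} (\<lambda>x. ?D x * \<phi> x) \<ge> 0"
    by (rule supersol_compare[OF R f even u \<phi>m \<phi>bd _ pos]) (auto simp: \<phi>_def)
  have "(\<lambda>x. ?D x * \<phi> x) absolutely_integrable_on {-R<..<R}"
    by (rule absolutely_integrable_test_product[OF D \<phi>m \<phi>bd])
  then have half: "(\<lambda>x. ?D x * \<phi> x) absolutely_integrable_on {0<..<R}"
    by (rule set_integrable_subset) (use R in auto)
  have refl: "?D (-x) * \<phi> (-x) = ?D x * \<phi> x" if "x \<in> {0<..<R}" for x
    using u_even[of x] that by (simp add: \<phi>_def)
  have half': "(\<lambda>x. ?D (-x) * \<phi> (-x)) absolutely_integrable_on {0<..<R}"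
    using half by (rule set_integrable_cong[THEN iffD1, rotated -1]) (use refl in auto)
  have "integral {-R<..<R} (\<lambda>x. ?D x * \<phi> x) = integral {0<..<R} (\<lambda>x. ?D x * \<phi> x + ?D (-x) * \<phi> (-x))"
    using R by (intro integral_symmetric_interval(2)[OF _ half half']) simp
  also have "\<dots> = integral {0<..<R} (\<lambda>x. 2 * (?D x * \<phi> x))"
    by (rule Henstock_Kurzweil_Integration.integral_cong) (simp only: refl mult_2)
  also have "\<dots> = 2 * integral {0<..<R} (\<lambda>x. ?D x * \<phi> x)" by simp
  also have "integral {0<..<R} (\<lambda>x. ?D x * \<phi> x) = (\<integral>x. ?D x * \<phi> x \<partial>?M)"
    using half by (intro lebesgue_integral_eq_integral[symmetric])
      (auto simp: absolutely_integrable_on_iff_integrable)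
  finally have ge: "(\<integral>x. ?D x * \<phi> x \<partial>?M) \<ge> 0"
    using whole by simp
  have Di: "integrable ?M (\<lambda>x. ?D x * \<phi> x)"
    using half by (simp add: absolutely_integrable_on_iff_integrable)
  \<comment> \<open>K is the value at c of \<open>u - green R f\<close>, taken through the
    continuous representative v. Since \<phi> has mean 0, subtracting K leaves the tested integral
    unchanged. Afterwards the difference is negative on \<open>(a, c)\<close> and nonnegative beyond
    c, opposite to the sign of \<phi>, which contradicts \<open>ge\<close>.\<close>
  define K where "K = v c - green R f c"
  have Ki: "integrable ?M (\<lambda>x. K * \<phi> x - ?D x * \<phi> x)"
    by (intro Bochner_Integration.integrable_diff integrable_mult_right \<phi>i Di)
  have "(\<integral>x. K * \<phi> x - ?D x * \<phi> x \<partial>?M) = K * 0 - (\<integral>x. ?D x * \<phi> x \<partial>?M)"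
    using \<phi>0 by (subst Bochner_Integration.integral_diff) (auto intro!: integrable_mult_right \<phi>i Di)
  then have le: "(\<integral>x. K * \<phi> x - ?D x * \<phi> x \<partial>?M) \<le> 0" using ge by simp
  have "AE x in lborel. x \<in> {0<..<R} \<longrightarrow> u x = v x"
    using uv by eventually_elim auto
  then have uvM: "AE x in ?M. u x = v x"
    by (intro AE_lborel_on_iff[THEN iffD1]) simp_all
  have strict: "AE x in ?M. 0 \<le> K * \<phi> x - ?D x * \<phi> x \<and> (x \<in> {a<..<c} \<longrightarrow> 0 < K * \<phi> x - ?D x * \<phi> x)"
    using uvM AE_space
  proof eventually_elim
    fix x assume uvx: "u x = v x" and "x \<in> space ?M"
    then have x: "0 < x" "x < R" by auto
    consider "x < a" | "a \<le> x" "x < c" | "c \<le> x" by linarith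
    then show "0 \<le> K * \<phi> x - ?D x * \<phi> x \<and> (x \<in> {a<..<c} \<longrightarrow> 0 < K * \<phi> x - ?D x * \<phi> x)"
    proof cases
      case 1 then show ?thesis using x by (simp add: \<phi>_def)
    next
      case 2
      then have "v x < v c" "green R f c \<le> green R f x"
        using v_mono[of x c] anti[of x c] a c by auto
      then show ?thesis using 2 x uvx by (simp add: \<phi>_def K_def)
    next
      case 3
      then have "v c \<le> v x" "green R f x \<le> green R f c"
        using v_mono[of c x] anti[of c x] a c x by (cases "c = x"; auto)+
      then show ?thesis using 3 x uvx a c by (simp add: \<phi>_def K_def)
    qed
  qed
  then have nn: "AE x in ?M. 0 \<le> K * \<phi> x - ?D x * \<phi> x" by eventually_elim simp
  then have "(\<integral>x. K * \<phi> x - ?D x * \<phi> x \<partial>?M) \<ge> 0" by (rule integral_nonneg_AE)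
  then have "(\<integral>x. K * \<phi> x - ?D x * \<phi> x \<partial>?M) = 0" using le by linarith
  then have "AE x in ?M. K * \<phi> x - ?D x * \<phi> x = 0"
    using integral_nonneg_eq_0_iff_AE[OF Ki nn] by simp
  then have "AE x in ?M. x \<notin> {a<..<c}"
    using strict by eventually_elim auto
  then have "AE x in lborel. x \<in> {0<..<R} \<longrightarrow> x \<notin> {a<..<c}"
    by (intro AE_lborel_on_iff[THEN iffD2]) simp_all
  then have "AE x in lborel. x \<notin> {a<..<c}"
    by eventually_elim (use a r0 c in auto)
  then have "c \<le> a" by (rule AE_not_in_interval_imp_le)
  then show False using c(1) by simp
qed

section \<open>Total mass of f, positivity at every point, reflection\<close>

lemma has_integral_sign_split:
  assumes f: "weighted_integrable R f" and r0: "0 < r0" "r0 < R"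
    and pos: "AE s in lebesgue_on {0<..<R}. s < r0 \<longrightarrow> f s \<ge> 0"
    and neg: "AE s in lebesgue_on {0<..<R}. r0 < s \<longrightarrow> f s \<le> 0"
    and int: "fminus f integrable_on {r0<..<R}"
  shows "(f has_integral (integral {0<..<r0} (fplus f) - integral {r0<..<R} (fminus f))) {0<..<R}"
proof -
  have "(inner_part r0 f has_integral integral {0<..<r0} (fplus f)) {0<..<R}"
    using has_integral_integral_lebesgue_on[OF fplus_integrable_inner(1)[OF f r0]]
    by (simp add: fplus_integrable_inner(2)[OF f r0])
  moreover have "(outer_part r0 f has_integral integral {r0<..<R} (fminus f)) {0<..<R}"
  proof -
    have "{r0<..} \<inter> {0<..<R} = {r0<..<R}" using r0 by auto
    then show ?thesis
      using integrable_integral[OF int] unfolding outer_part_def[abs_def]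
      by (subst has_integral_restrict_Int) simp
  qed
  ultimately have "((\<lambda>s. inner_part r0 f s - outer_part r0 f s) has_integral
      (integral {0<..<r0} (fplus f) - integral {r0<..<R} (fminus f))) {0<..<R}"
    by (rule has_integral_diff)
  moreover have "AE s in lborel. s \<in> {0<..<R} \<longrightarrow> f s = inner_part r0 f s - outer_part r0 f s"
    using AE_split[OF pos neg] by (intro AE_lborel_on_iff[THEN iffD2]) simp_all
  ultimately show ?thesis
    by (subst has_integral_AE) assumption+
qed

text \<open>The decay condition speaks about every r, positivity of a solution only about almost
  every point. One nonpositive value at r forces, by \<open>green_ratio_antimono\<close>,
  nonpositive values on all of \<open>(r, R)\<close>, a set of positive measure.\<close>

lemma green_pos_AE_imp_pos_outer:
  assumes f: "weighted_integrable R f" and r0: "0 < r0" "r0 < R"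
    and neg: "AE s in lebesgue_on {0<..<R}. r0 < s \<longrightarrow> f s \<le> 0"
    and ae: "AE x in lborel. x \<in> {-R<..<R} \<longrightarrow> green R f x > 0"
    and r: "r \<in> {r0<..<R}"
  shows "green R f r > 0"
proof (rule ccontr)
  assume "\<not> green R f r > 0"
  then have le: "green R f r \<le> 0" by simp
  have nonpos: "green R f x \<le> 0" if x: "x \<in> {r<..<R}" for x
  proof -
    have "(R - r) * green R f x \<le> (R - x) * green R f r"
      using x r r0 by (intro green_ratio_antimono[OF f neg]) auto
    also have "\<dots> \<le> 0" using le x by (intro mult_nonneg_nonpos) auto
    finally show ?thesis using r by (simp add: mult_le_0_iff)
  qed
  have "AE x in lborel. x \<notin> {r<..<R}"
    using ae
  proof eventually_elim
    fix x assume "x \<in> {-R<..<R} \<longrightarrow> green R f x > 0"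
    then show "x \<notin> {r<..<R}"
      using nonpos[of x] r r0 by auto
  qed
  then have "R \<le> r" by (rule AE_not_in_interval_imp_le)
  then show False using r by simp
qed

lemma C1_on_reflect:
  assumes "C1_on R v v'"
  shows "C1_on R (\<lambda>x. v (-x)) (\<lambda>x. - v' (-x))"
proof -
  have c: "continuous_on {-R..R} v'"
    and d: "\<And>x. x \<in> {-R..R} \<Longrightarrow> (v has_real_derivative v' x) (at x within {-R..R})"
    using assms by (auto simp: C1_on_def)
  have "continuous_on {-R..R} (\<lambda>x. - v' (-x))"
    by (intro continuous_on_minus continuous_on_compose2[OF c] continuous_on_id) auto
  then show ?thesis
    unfolding C1_on_def using has_derivative_reflect_interval[OF d] by blast
qed

lemma AE_lborel_reflect:
  assumes "AE x in lborel. P (x::real)"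
  shows "AE x in lborel. P (-x)"
proof -
  have "AE x in distr lborel borel (uminus :: real \<Rightarrow> real). P x"
    using assms by (simp only: lborel_distr_uminus)
  then show ?thesis
    by (rule AE_distrD[rotated]) simp
qed

section \<open>Positivity, its equivalence with decay, and flatness\<close>

theorem theorem1:
  fixes R r0 :: real and f :: "real \<Rightarrow> real"
  assumes R_pos: "R > 0"
    and f_even: "\<forall>x\<in>{-R<..<R}. f (-x) = f x"
    and f_L1_delta: "(\<lambda>s. f s * (R - s)) absolutely_integrable_on {0<..<R}"
    and r0: "0 < r0" "r0 < R"
    and f_nonneg: "AE r in lborel. r \<in> {0<..<r0} \<longrightarrow> f r \<ge> 0"
    and fplus_nonzero: "\<not> (AE r in lborel. r \<in> {0<..<r0} \<longrightarrow> fplus f r = 0)"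
    and f_nonpos: "AE r in lborel. r \<in> {r0<..<R} \<longrightarrow> f r \<le> 0"
  defines "balance \<equiv> integral {0<..<r0} (\<lambda>s. fplus f s * (R - r0))
                       > integral {r0<..<R} (\<lambda>s. fminus f s * (R - s))"
    and "decay \<equiv> (\<forall>r\<in>{r0<..<R}.
            integral {r<..<R} (\<lambda>t. integral {r0<..<t} (fminus f))
              < (R - r) * integral {0<..<r0} (fplus f))"
  shows
    "(balance \<and> decay \<longrightarrow>
       (\<forall>u. (\<forall>x\<in>{-R<..<R}. u (-x) = u x) \<and> very_weak_supersol R f u \<longrightarrow>
          (AE x in lborel. x \<in> {-R<..<R} \<longrightarrow> u x > 0) \<and>
          (\<forall>v v'. (AE x in lborel. x \<in> {-R<..<R} \<longrightarrow> u x = v x) \<and> C1_on R v v' \<longrightarrow>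
                  v' R \<le> 0 \<and> v' (-R) \<ge> 0)))
     \<and>
     (balance \<longrightarrow>
       (\<forall>u. very_weak_sol R f u \<longrightarrow>
          ((AE x in lborel. x \<in> {-R<..<R} \<longrightarrow> u x > 0) \<longleftrightarrow> decay)))
     \<and>
     (balance \<and> decay \<and> fminus f integrable_on {r0<..<R} \<longrightarrow>
       (\<forall>u. very_weak_sol R f u \<longrightarrow>
          (\<exists>v v'. (AE x in lborel. x \<in> {-R<..<R} \<longrightarrow> u x = v x) \<and> C1_on R v v' \<and>
             ((v' R = 0 \<and> v' (-R) = 0) \<longleftrightarrow>
                integral {0<..<r0} (fplus f) = integral {r0<..<R} (fminus f)) \<and>
             ((v' R = 0 \<and> v' (-R) = 0) \<longleftrightarrow> integral {0<..<R} f = 0))))"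
proof -
  let ?U = "green R f" and ?S = "{-R<..<R}"
  define A where "A = integral {0<..<r0} (fplus f)"
  have even: "f (-x) = f x" if "x \<in> ?S" for x using f_even that by blast
  have f: "weighted_integrable R f"
    using f_L1_delta by (simp add: absolutely_integrable_on_iff_integrable)
  have "AE s in lborel. s \<in> {0<..<R} \<longrightarrow> (s < r0 \<longrightarrow> f s \<ge> 0)"
    using f_nonneg by eventually_elim auto
  then have pos: "AE s in lebesgue_on {0<..<R}. s < r0 \<longrightarrow> f s \<ge> 0"
    by (intro AE_lborel_on_iff[THEN iffD1]) simp_all
  have "AE s in lborel. s \<in> {0<..<R} \<longrightarrow> (r0 < s \<longrightarrow> f s \<le> 0)"
    using f_nonpos by eventually_elim auto
  then have neg: "AE s in lebesgue_on {0<..<R}. r0 < s \<longrightarrow> f s \<le> 0"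
    by (intro AE_lborel_on_iff[THEN iffD1]) simp_all
  have formula: "?U r = (R - r) * A - green R (outer_part r0 f) r" if "r0 \<le> r" "r \<le> R" for r
    unfolding A_def by (rule green_outer_formula[OF f r0 pos neg that])
  have balance_iff: "balance \<longleftrightarrow> ?U r0 > 0"
    using formula[of r0] r0 green_outer_part_at[OF f r0]
    by (simp add: balance_def A_def mult.commute)
  have decay_iff: "decay \<longleftrightarrow> (\<forall>r\<in>{r0<..<R}. ?U r > 0)"
    unfolding decay_def A_def[symmetric]
  proof (intro ball_cong refl)
    fix r assume "r \<in> {r0<..<R}"
    then show "integral {r<..<R} (\<lambda>t. integral {r0<..<t} (fminus f)) < (R - r) * A \<longleftrightarrow> ?U r > 0"
      using formula[of r] green_outer_part[OF f r0(1), of r] r0 by simp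
  qed
  have U_pos: "?U x > 0" if bd: balance decay and x: "x \<in> ?S" for x
  proof (cases "\<bar>x\<bar> > r0")
    case True
    then have "?U \<bar>x\<bar> > 0" using bd(2) x unfolding decay_iff by auto
    then show ?thesis by (simp add: green_def)
  next
    case False
    then have "?U r0 \<le> ?U \<bar>x\<bar>"
      using r0 by (intro green_antimono_inner[OF f pos]) auto
    then show ?thesis using bd(1) balance_iff by (simp add: green_def)
  qed
  have anti: "?U y \<le> ?U x" if decay "r0 < x" "x \<le> y" "y < R" for x y
    using that r0 decay_iff by (intro green_antimono_outer[OF f neg]) (auto intro: less_imp_le)

  have part1: "(AE x in lborel. x \<in> ?S \<longrightarrow> u x > 0) \<and>
      (\<forall>v v'. (AE x in lborel. x \<in> ?S \<longrightarrow> u x = v x) \<and> C1_on R v v' \<longrightarrow> v' R \<le> 0 \<and> v' (-R) \<ge> 0)"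
    if bd: balance decay and u_even: "\<forall>x\<in>?S. u (-x) = u x" and u: "very_weak_supersol R f u" for u
  proof (intro conjI allI impI)
    have ue: "u (-x) = u x" if "x \<in> ?S" for x using u_even that by blast
    have "AE x in lborel. x \<in> ?S \<longrightarrow> u x \<ge> ?U x"
      by (rule supersol_ge_green[OF R_pos f even u ue])
    then show "AE x in lborel. x \<in> ?S \<longrightarrow> u x > 0"
    proof eventually_elim
      fix x assume "x \<in> ?S \<longrightarrow> ?U x \<le> u x"
      then show "x \<in> ?S \<longrightarrow> u x > 0" using U_pos[OF bd, of x] by linarith
    qed
    fix v v' assume v: "(AE x in lborel. x \<in> ?S \<longrightarrow> u x = v x) \<and> C1_on R v v'"
    have endpoint: "w' R \<le> 0" if "AE x in lborel. x \<in> ?S \<longrightarrow> u x = w x" "C1_on R w w'" for w w'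
      by (rule supersol_C1_endpoint[OF R_pos f even u ue less_imp_le[OF r0(1)] r0(2) anti[OF bd(2)] that])
    show "v' R \<le> 0" using endpoint v by blast
    \<comment> \<open>Since u is even, the reflection of v is another C1 representative of u; the
      estimate at R applied to it gives the one at \<open>-R\<close>.\<close>
    have "AE x in lborel. - x \<in> ?S \<longrightarrow> u (-x) = v (-x)"
      using v AE_lborel_reflect by blast
    then have "AE x in lborel. x \<in> ?S \<longrightarrow> u x = v (-x)"
      by eventually_elim (use ue in auto)
    then have "- v' (- R) \<le> 0"
      using v by (intro endpoint[of "\<lambda>x. v (-x)" "\<lambda>x. - v' (-x)"] C1_on_reflect) auto
    then show "v' (-R) \<ge> 0" by simp
  qed

  have part2: "(AE x in lborel. x \<in> ?S \<longrightarrow> u x > 0) \<longleftrightarrow> decay"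
    if b: balance and u: "very_weak_sol R f u" for u
  proof
    have uU: "AE x in lborel. x \<in> ?S \<longrightarrow> u x = ?U x"
      by (rule very_weak_sol_unique[OF R_pos f even u])
    {
      assume "AE x in lborel. x \<in> ?S \<longrightarrow> u x > 0"
      with uU have "AE x in lborel. x \<in> ?S \<longrightarrow> ?U x > 0" by eventually_elim auto
      then show decay
        unfolding decay_iff using green_pos_AE_imp_pos_outer[OF f r0 neg] by blast
    }
    assume decay
    with uU show "AE x in lborel. x \<in> ?S \<longrightarrow> u x > 0"
      by (auto elim!: eventually_mono dest: U_pos[OF b])
  qed

  have part3: "\<exists>v v'. (AE x in lborel. x \<in> ?S \<longrightarrow> u x = v x) \<and> C1_on R v v' \<and>
      ((v' R = 0 \<and> v' (-R) = 0) \<longleftrightarrow> integral {0<..<r0} (fplus f) = integral {r0<..<R} (fminus f)) \<and>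
      ((v' R = 0 \<and> v' (-R) = 0) \<longleftrightarrow> integral {0<..<R} f = 0)"
    if int: "fminus f integrable_on {r0<..<R}" and u: "very_weak_sol R f u" for u
  proof -
    define F where "F = (\<lambda>t. integral {0..t} f)"
    define v' where "v' = (\<lambda>x. F (max (-x) 0) - F (max x 0))"
    note hi = has_integral_sign_split[OF f r0 pos neg int]
    then have "f integrable_on {0..R}"
      by (auto simp: integrable_on_Icc_iff_Ioo)
    then have "C1_on R ?U v'"
      unfolding v'_def F_def by (rule C1_on_green[OF R_pos f])
    moreover have "integral {0<..<R} f = integral {0<..<r0} (fplus f) - integral {r0<..<R} (fminus f)"
      using hi by (rule integral_unique)
    \<comment> \<open>At each endpoint one of the two terms is \<open>F 0 = 0\<close>, so both
      slopes equal the total mass of f up to sign, and the two flatness criteria become the same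
      equation.\<close>
    moreover have "v' R = - integral {0<..<R} f" "v' (-R) = integral {0<..<R} f"
      using R_pos by (simp_all add: v'_def F_def integral_open_interval_real)
    moreover have "AE x in lborel. x \<in> ?S \<longrightarrow> u x = ?U x"
      by (rule very_weak_sol_unique[OF R_pos f even u])
    ultimately show ?thesis
      by (intro exI[of _ ?U] exI[of _ v']) auto
  qed
  show ?thesis
    apply (intro conjI)
      apply (intro impI allI, elim conjE, rule part1; assumption)
     apply (intro impI allI, rule part2; assumption)
    apply (intro impI allI, elim conjE, rule part3; assumption)
    done
qed

end
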